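(* Let $n\geq 2$ be even, let $u\in F_n$ be a reduced non-alternating word of length at least $3$, let $w=u\,\theta^{n/2}(u)^{-1}$ be of length $k$ and not a proper power, and suppose that $P_n(w)$ is irreducible. Then $P_n(w)$ is $(2,k,\nu)$-special if and only if the following hold: (a) $n=\nu\, l(u)$, $l(u)\equiv 2 \bmod 4$, $l(u)\geq 6$; (b) $\bar{\mathcal{A}},\bar{\mathcal{B}}$ are each sets of the form $\{\pm\nu,\pm3\nu,\ldots,\pm(n/(2\nu)-2)\nu,\ n/2\}$; (c) there exists some $0<q_0<n$ with $(q_0,\nu)=1$ such that $\bar{\mathcal{Q}}=\{q_0,q_0+2\nu,\ldots,q_0+(n/\nu-2)\nu\}$.
   Context: $F_n$ is the free group with basis $x_0,\ldots,x_{n-1}$; subscripts are taken modulo $n$; $\theta(x_i)=x_{i+1}$; $l(u)$ is the length of $u$; $(a,b)$ is the greatest common divisor. $P_n(w)=\langle x_0,\ldots,x_{n-1}\mid w,\theta(w),\ldots,\theta^{n-1}(w)\rangle$. $P_n(w)$ is irreducible if the greatest common divisor of $n$ and all differences of subscripts of letters occurring in $w$ is $1$. A word of length at least 2 is alternating if it has no subword of the form $(x_ix_j)^{\pm1}$. Multisets (of residues mod $n$, counted with multiplicity): $\bar{\mathcal{A}}'=\{a\mid$ there is a subword $x_ix_{i+a}^{-1}$ of $u\}$; $\bar{\mathcal{B}}'=\{b\mid$ there is a subword $x_i^{-1}x_{i+b}$ of $u\}$; $\bar{\mathcal{Q}}=\{q\mid$ there is a subword $x_ix_{i+q}$ or $x_{i+q}^{-1}x_i^{-1}$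 of $u\}$. Let $\iota(u),\tau(u)$ be the initial and terminal letters of $u$ (a letter $x_i$ is positive, $x_i^{-1}$ is negative). With $\cup$ denoting multiset sum, $(\bar{\mathcal{A}},\bar{\mathcal{B}})$ equals: $(\bar{\mathcal{A}}'\cup\{n/2\},\bar{\mathcal{B}}'\cup\{n/2\})$ if $\iota(u),\tau(u)$ are both positive or both negative; $(\bar{\mathcal{A}}',\bar{\mathcal{B}}'\cup\{n/2,n/2\})$ if $\iota(u)$ is positive and $\tau(u)$ negative; $(\bar{\mathcal{A}}'\cup\{n/2,n/2\},\bar{\mathcal{B}}')$ if $\iota(u)$ is negative and $\tau(u)$ positive. Saying such a multiset is a "set of the form $\{\pm c_1,\ldots,\pm c_r,n/2\}$" means that it has no repeated elements and, mod $n$, consists of $n/2$ and exactly one of $c_j,-c_j$ for each $j$ (each sign being chosen independently). The equality in (c) is an equality of multisets of residues mod $n$ (in particular $\bar{\mathcal{Q}}$ has no repeated elements). Star graph: for a presentation $\langle X\mid R\rangle$ with cyclically reduced relators, let $\tilde R$ be the set of all cyclic permutations of elements of $R\cup R^{-1}$. The star graph is the undirected graph (multiple edges allowed) with vertex set $X\cup X^{-1}$ and an edge joining $x$ and $y$ ($x,y\in X\cup X^{-1}$) for each distinct word in $\tilde R$ of the form $xy^{-1}z$, where the edges arising from the inverse pair $xy^{-1}z$ and $yx^{-1}z^{-1}$ are identified. $(m,k,\nu)$-special: let $m\geq 2$, $k\geq 3$, $\nu\geq 1$. A finite presentation is $(m,k,\nu)$-special if (a) its star graph has $\nu$ connected components,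 which are pairwise isomorphic, each being a connected bipartite graph of diameter $m$ and girth $2m$ in which each vertex has degree at least $3$; (b) each relator has length $k$; (c) if $m=2$ then $k\geq 4$. (Girth is the minimal length of a reduced closed path; a pair of parallel edges gives girth at most $2$.) *)

theory Defs
  imports Main "HOL-Library.Multiset" "HOL-Library.Extended_Nat"
begin

section \<open>Free groups\<close>

text \<open>
  The letter \<open>(a, True)\<close> is the generator \<open>a\<close> and \<open>(a, False)\<close> its inverse.
  Elements of the free group are represented by reduced words, and their product is the
  reduction of the concatenation.
\<close>

type_synonym 'a letter = "'a \<times> bool"
type_synonym 'a word = "'a letter list"

definition letter_inv :: "'a letter \<Rightarrow> 'a letter" where
  "letter_inv x = (fst x, \<not> snd x)"

definition word_inv :: "'a word \<Rightarrow> 'a word" where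
  "word_inv w = rev (map letter_inv w)"

definition reduced :: "'a word \<Rightarrow> bool" where
  "reduced w \<longleftrightarrow> successively (\<lambda>x y. y \<noteq> letter_inv x) w"

definition cyclically_reduced :: "'a word \<Rightarrow> bool" where
  "cyclically_reduced w \<longleftrightarrow> reduced w \<and> (w \<noteq> [] \<longrightarrow> hd w \<noteq> letter_inv (last w))"

fun push_letter :: "'a letter \<Rightarrow> 'a word \<Rightarrow> 'a word" where
  "push_letter x [] = [x]"
| "push_letter x (y # ys) = (if y = letter_inv x then ys else x # y # ys)"

definition reduce :: "'a word \<Rightarrow> 'a word" where
  "reduce w = foldr push_letter w []"

definition free_group :: "'a set \<Rightarrow> 'a word set" where
  "free_group X = {w. reduced w \<and> fst ` set w \<subseteq> X}"

definition free_mult :: "'a word \<Rightarrow> 'a word \<Rightarrow> 'a word" where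
  "free_mult v w = reduce (v @ w)"

fun free_power :: "'a word \<Rightarrow> nat \<Rightarrow> 'a word" where
  "free_power v 0 = []"
| "free_power v (Suc p) = free_mult v (free_power v p)"

definition proper_power :: "'a set \<Rightarrow> 'a word \<Rightarrow> bool" where
  "proper_power X w \<longleftrightarrow> (\<exists>v \<in> free_group X. \<exists>p \<ge> 2. w = free_power v p)"

definition alternating :: "'a word \<Rightarrow> bool" where
  "alternating w \<longleftrightarrow> length w \<ge> 2 \<and> successively (\<lambda>x y. snd x \<noteq> snd y) w"


section \<open>Undirected multigraphs\<close>

text \<open>
  Each edge carries its set of end points, which has two elements, or one for a loop.
\<close>

record ('v, 'e) multigraph =
  verts :: "'v set"
  edges :: "'e set"
  ends :: "'e \<Rightarrow> 'v set"

fun walk :: "('v, 'e) multigraph \<Rightarrow> 'v \<Rightarrow> 'e list \<Rightarrow> 'v \<Rightarrow> bool" where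
  "walk G x [] y \<longleftrightarrow> x \<in> verts G \<and> x = y"
| "walk G x (e # es) y \<longleftrightarrow>
     x \<in> verts G \<and> e \<in> edges G \<and> (\<exists>z. ends G e = {x, z} \<and> walk G z es y)"

definition reachable :: "('v, 'e) multigraph \<Rightarrow> 'v \<Rightarrow> 'v \<Rightarrow> bool" where
  "reachable G x y \<longleftrightarrow> (\<exists>es. walk G x es y)"

definition connected_graph :: "('v, 'e) multigraph \<Rightarrow> bool" where
  "connected_graph G \<longleftrightarrow>
     verts G \<noteq> {} \<and> (\<forall>x \<in> verts G. \<forall>y \<in> verts G. reachable G x y)"

definition induced_subgraph :: "('v, 'e) multigraph \<Rightarrow> 'v set \<Rightarrow> ('v, 'e) multigraph" where
  "induced_subgraph G C =
     \<lparr> verts = C, edges = {e \<in> edges G. ends G e \<subseteq> C}, ends = ends G \<rparr>"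

definition components :: "('v, 'e) multigraph \<Rightarrow> ('v, 'e) multigraph set" where
  "components G = (\<lambda>x. induced_subgraph G {y. reachable G x y}) ` verts G"

definition isomorphic_graphs ::
    "('v, 'e) multigraph \<Rightarrow> ('v, 'e) multigraph \<Rightarrow> bool" where
  "isomorphic_graphs G H \<longleftrightarrow>
     (\<exists>f g. bij_betw f (verts G) (verts H) \<and> bij_betw g (edges G) (edges H) \<and>
       (\<forall>e \<in> edges G. ends H (g e) = f ` ends G e))"

definition bipartite :: "('v, 'e) multigraph \<Rightarrow> bool" where
  "bipartite G \<longleftrightarrow>
     (\<exists>A B. A \<union> B = verts G \<and> A \<inter> B = {} \<and>
       (\<forall>e \<in> edges G. \<exists>a \<in> A. \<exists>b \<in> B. ends G e = {a, b}))"

text \<open>Loops count twice towards the degree.\<close>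

definition degree :: "('v, 'e) multigraph \<Rightarrow> 'v \<Rightarrow> nat" where
  "degree G x = card {e \<in> edges G. x \<in> ends G e} + card {e \<in> edges G. ends G e = {x}}"

definition distance :: "('v, 'e) multigraph \<Rightarrow> 'v \<Rightarrow> 'v \<Rightarrow> enat" where
  "distance G x y = (INF es \<in> {es. walk G x es y}. enat (length es))"

definition diameter :: "('v, 'e) multigraph \<Rightarrow> enat" where
  "diameter G = (SUP x \<in> verts G. SUP y \<in> verts G. distance G x y)"

text \<open>
  A closed path is reduced if it never runs back along the edge just traversed. Since edges
  are recorded rather than vertices, two parallel edges form a reduced closed path of length 2.
\<close>

definition reduced_closed_path :: "('v, 'e) multigraph \<Rightarrow> 'e list \<Rightarrow> bool" where
  "reduced_closed_path G es \<longleftrightarrow>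
     es \<noteq> [] \<and> (\<exists>x. walk G x es x) \<and> successively (\<noteq>) es"

definition girth :: "('v, 'e) multigraph \<Rightarrow> enat" where
  "girth G = (INF es \<in> {es. reduced_closed_path G es}. enat (length es))"


section \<open>Presentations, star graphs and special presentations\<close>

record 'a presentation =
  gens :: "'a set"
  rels :: "'a word set"

definition symmetrised_relators :: "'a presentation \<Rightarrow> 'a word set" where
  "symmetrised_relators P = {rotate i r | i r. r \<in> rels P \<union> word_inv ` rels P}"

text \<open>
  \<open>star_flip\<close> sends \<open>x y\<inverse> z\<close> to \<open>y x\<inverse> z\<inverse>\<close>. An edge of the star graph is
  the pair consisting of a word and its flip; the initial letters of these
  two words, \<open>x\<close> and \<open>y\<close>, are its end points.
\<close>

fun star_flip :: "'a word \<Rightarrow> 'a word" where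
  "star_flip (x # y' # z) = letter_inv y' # letter_inv x # word_inv z"
| "star_flip v = v"

definition star_graph :: "'a presentation \<Rightarrow> ('a letter, 'a word set) multigraph" where
  "star_graph P =
     \<lparr> verts = gens P \<times> UNIV,
       edges = {{v, star_flip v} | v. v \<in> symmetrised_relators P \<and> length v \<ge> 2},
       ends = (\<lambda>e. hd ` e) \<rparr>"

definition special :: "nat \<Rightarrow> nat \<Rightarrow> nat \<Rightarrow> 'a presentation \<Rightarrow> bool" where
  "special m k \<nu> P \<longleftrightarrow>
     m \<ge> 2 \<and> k \<ge> 3 \<and> \<nu> \<ge> 1 \<and>
     finite (gens P) \<and> finite (rels P) \<and>
     (\<forall>r \<in> rels P. fst ` set r \<subseteq> gens P \<and> cyclically_reduced r) \<and>
     card (components (star_graph P)) = \<nu> \<and>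
     (\<forall>C \<in> components (star_graph P). \<forall>D \<in> components (star_graph P).
        isomorphic_graphs C D) \<and>
     (\<forall>C \<in> components (star_graph P).
        connected_graph C \<and> bipartite C \<and> diameter C = enat m \<and> girth C = enat (2 * m) \<and>
        (\<forall>x \<in> verts C. degree C x \<ge> 3)) \<and>
     (\<forall>r \<in> rels P. length r = k) \<and>
     (m = 2 \<longrightarrow> k \<ge> 4)"


section \<open>Cyclically presented groups\<close>

text \<open>The generator \<open>x\<^sub>i\<close> of \<open>F\<^sub>n\<close> is represented by the number \<open>i < n\<close>.\<close>

definition shift :: "nat \<Rightarrow> nat word \<Rightarrow> nat word" where
  "shift n = map (\<lambda>(i, s). ((i + 1) mod n, s))"

definition cyclic_presentation :: "nat \<Rightarrow> nat word \<Rightarrow> nat presentation" where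
  "cyclic_presentation n w =
     \<lparr> gens = {..<n}, rels = (\<lambda>i. (shift n ^^ i) w) ` {..<n} \<rparr>"

definition irreducible_presentation :: "nat \<Rightarrow> nat word \<Rightarrow> bool" where
  "irreducible_presentation n w \<longleftrightarrow>
     Gcd (insert (int n) {int i - int j | i j. i \<in> fst ` set w \<and> j \<in> fst ` set w}) = 1"

text \<open>
  Residues modulo \<open>n\<close> are represented by integers in \<open>{0..<n}\<close>. The members of
  \<open>zip u (tl u)\<close> are the subwords of length 2 of \<open>u\<close>, one for each position.
\<close>

definition A'_mset :: "nat \<Rightarrow> nat word \<Rightarrow> int multiset" where
  "A'_mset n u =
     mset [(int j - int i) mod int n. ((i, True), (j, False)) \<leftarrow> zip u (tl u)]"

definition B'_mset :: "nat \<Rightarrow> nat word \<Rightarrow> int multiset" where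
  "B'_mset n u =
     mset [(int j - int i) mod int n. ((i, False), (j, True)) \<leftarrow> zip u (tl u)]"

definition Q_mset :: "nat \<Rightarrow> nat word \<Rightarrow> int multiset" where
  "Q_mset n u =
     mset [(int j - int i) mod int n. ((i, True), (j, True)) \<leftarrow> zip u (tl u)] +
     mset [(int i - int j) mod int n. ((i, False), (j, False)) \<leftarrow> zip u (tl u)]"

definition A_mset :: "nat \<Rightarrow> nat word \<Rightarrow> int multiset" where
  "A_mset n u = A'_mset n u +
     (if snd (hd u) = snd (last u) then {# int n div 2 #}
      else if snd (hd u) then {#}
      else {# int n div 2, int n div 2 #})"

definition B_mset :: "nat \<Rightarrow> nat word \<Rightarrow> int multiset" where
  "B_mset n u = B'_mset n u +
     (if snd (hd u) = snd (last u) then {# int n div 2 #}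
      else if snd (hd u) then {# int n div 2, int n div 2 #}
      else {#})"

text \<open>
  \<open>signed_set_form n C M\<close> says that \<open>M\<close> is a set of the form \<open>{\<plusminus>c | c \<in> C} \<union> {n/2}\<close> modulo
  \<open>n\<close>, with one independently chosen sign for each \<open>c\<close>.
\<close>

definition signed_set_form :: "nat \<Rightarrow> int set \<Rightarrow> int multiset \<Rightarrow> bool" where
  "signed_set_form n C M \<longleftrightarrow>
     (\<exists>s. (\<forall>c \<in> C. s c = c \<or> s c = - c) \<and>
          M = mset_set (insert (int n div 2) ((\<lambda>c. s c mod int n) ` C)))"

end

theory Submission
  imports Defs
begin

text \<open>
  The word \<open>w\<close> satisfies \<open>\<theta>\<^sup>n\<^sup>/\<^sup>2(w) = w\<inverse>\<close>, and no other coincidences occur among the cyclic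
  permutations of its translates. So the edges of the star graph joining two given vertices are
  counted by the multiplicity of their subscript difference in a multiset built from
  \<open>A\<close>, \<open>B\<close> or \<open>Q\<close>, according to the signs of the vertices.

  A bipartite graph has diameter \<open>2\<close> and girth \<open>4\<close> iff it is a simple complete bipartite graph with at
  least two vertices on each side. If all components are of this type, paths of length three close
  up to edges, so the subscript differences occurring between positive vertices form a coset
  \<open>m + 2m\<int>\<close>, those between negative vertices the same coset, and those in \<open>Q\<close> a coset
  \<open>q + 2m\<int>\<close>. Conversely, for such differences the function \<open>x\<^sub>i \<mapsto> i\<close>,
  \<open>x\<^sub>i\<inverse> \<mapsto> i - q + m\<close> modulo \<open>2m\<close> identifies the components with residues modulo \<open>m\<close>,
  whence \<open>m = \<nu>\<close>.
\<close>

section \<open>Multigraphs\<close>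

text \<open>Each subword of u recurs inverted in the second half of w. Inversion preserves the sign
  patterns x y^-1 and x^-1 y and negates their differences, while it exchanges the two patterns of
  equal signs. So A' and B' enter the edge count together with their negatives, but Q enters once.
  The two places where the halves of w meet contribute n/2 each, to A or B according to the signs at
  the ends of u. As n/2 is its own negative, A' and B' contribute an even number there; multiplicity
  one therefore forces exactly one junction on each level, and the free signs in (b) record which of
  d and -d occurs in u itself.

  The numerical conditions come from n = 2ml. In a simple star graph a positive vertex has l(u)
  neighbours, l of them positive and l negative, so l(u) = 2l and n = m l(u). The difference n/2 =
  ml always occurs, hence lies in m + 2m\<int>, so l is odd and l(u) is 2 modulo 4; length at least
  3 rules out l = 1. Irreducibility excludes common divisors of q and m.\<close>

definition adjacent :: "('v, 'e) multigraph \<Rightarrow> 'v \<Rightarrow> 'v \<Rightarrow> bool" where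
  "adjacent G x y \<longleftrightarrow> (\<exists>e \<in> edges G. ends G e = {x, y})"

lemma adjacentE:
  assumes "adjacent G x y"
  obtains e where "e \<in> edges G" "ends G e = {x, y}"
  using assms unfolding adjacent_def by blast

lemma adjacent_sym: "adjacent G x y \<Longrightarrow> adjacent G y x"
  unfolding adjacent_def by (simp add: insert_commute)

lemma walk_ConsI:
  assumes "e \<in> edges G" "ends G e = {x, z}" "x \<in> verts G" "walk G z es y"
  shows "walk G x (e # es) y"
  using assms by auto

lemma walk_start: "walk G x es y \<Longrightarrow> x \<in> verts G"
  by (cases es) auto

lemma walk_end: "walk G x es y \<Longrightarrow> y \<in> verts G"
  by (induction es arbitrary: x) auto

lemma reachable_refl: "x \<in> verts G \<Longrightarrow> reachable G x x"
  unfolding reachable_def by (rule exI[of _ "[]"]) simp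

lemma adjacent_imp_reachable:
  assumes "adjacent G x y" "x \<in> verts G" "y \<in> verts G"
  shows "reachable G x y"
  using assms unfolding reachable_def adjacent_def
  by (metis walk.simps)

text \<open>If every walk had length at least \<open>Suc d\<close>, so would the infimum; this also
  covers an empty set of walks, whose infimum is infinite.\<close>

lemma distance_le_imp_walk:
  assumes "distance G x y \<le> enat d"
  obtains es where "walk G x es y" "length es \<le> d"
proof (rule ccontr)
  assume "\<not> thesis"
  with that have "enat (Suc d) \<le> enat (length es)" if "walk G x es y" for es
    using \<open>walk G x es y\<close> not_less_eq_eq by (metis enat_ord_simps(1))
  then have "enat (Suc d) \<le> distance G x y"
    unfolding distance_def by (intro INF_greatest) auto
  with assms have "enat (Suc d) \<le> enat d"
    by (rule order_trans[rotated])
  then show False by simp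
qed

lemma distance_le_diameter:
  assumes "x \<in> verts G" "y \<in> verts G"
  shows "distance G x y \<le> diameter G"
  unfolding diameter_def using assms by (meson SUP_upper2 order_refl)

lemma distance_le_walk: "walk G x es y \<Longrightarrow> distance G x y \<le> enat (length es)"
  unfolding distance_def by (rule INF_lower) simp

lemma girth_le: "reduced_closed_path G es \<Longrightarrow> girth G \<le> enat (length es)"
  unfolding girth_def by (rule INF_lower) simp

text \<open>Two parallel edges, traversed there and back, are a reduced closed path of length
  two.\<close>

lemma inj_on_ends_of_girth:
  assumes wf: "\<And>e. e \<in> edges G \<Longrightarrow> \<exists>x \<in> verts G. \<exists>y \<in> verts G. ends G e = {x, y}"
    and girth: "girth G > enat 2"
  shows "inj_on (ends G) (edges G)"
proof (rule inj_onI, rule ccontr)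
  fix e e'
  assume e: "e \<in> edges G" "e' \<in> edges G" "ends G e = ends G e'" "e \<noteq> e'"
  obtain x y where xy: "x \<in> verts G" "y \<in> verts G" "ends G e = {x, y}"
    using wf[OF e(1)] by blast
  have "walk G x [e, e'] x"
    using e xy by (auto simp: insert_commute intro!: exI[of _ y])
  then have "reduced_closed_path G [e, e']"
    using e(4) unfolding reduced_closed_path_def by auto
  from girth_le[OF this] girth show False
    by (simp add: numeral_2_eq_2)
qed

text \<open>A walk between opposite sides has odd length, so one of length at most two is a single
  edge. As X and Y partition the vertices, \<open>x \<in> X \<longleftrightarrow> y \<in> Y\<close>
  means that x and y lie on opposite sides.\<close>

lemma bipartite_diameter_2_complete:
  assumes "bipartite G" "diameter G = enat 2"
  obtains X Y where "X \<union> Y = verts G" "X \<inter> Y = {}"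
    and "\<And>x y. x \<in> verts G \<Longrightarrow> y \<in> verts G \<Longrightarrow> adjacent G x y \<longleftrightarrow> (x \<in> X \<longleftrightarrow> y \<in> Y)"
proof -
  obtain X Y where XY: "X \<union> Y = verts G" "X \<inter> Y = {}"
    and e: "\<And>e. e \<in> edges G \<Longrightarrow> \<exists>a \<in> X. \<exists>b \<in> Y. ends G e = {a, b}"
    using assms(1) unfolding bipartite_def by metis
  have cross: "x \<in> X \<longleftrightarrow> y \<in> Y" if "adjacent G x y" for x y
    using that e XY(2) unfolding adjacent_def by (fastforce simp: doubleton_eq_iff)
  have "adjacent G x y" if xy: "x \<in> verts G" "y \<in> verts G" and side: "x \<in> X \<longleftrightarrow> y \<in> Y" for x y
  proof -
    have "distance G x y \<le> enat 2"
      using distance_le_diameter[OF xy] assms(2) by simp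
    then obtain es where es: "walk G x es y" "length es \<le> 2"
      by (rule distance_le_imp_walk)
    consider "es = []" | e1 where "es = [e1]" | e1 e2 where "es = [e1, e2]"
      using es(2) by (cases es rule: list.exhaust; cases "tl es" rule: list.exhaust) auto
    then show ?thesis
    proof cases
      case 1
      with es side XY xy show ?thesis by auto
    next
      case 2
      with es show ?thesis unfolding adjacent_def by auto
    next
      case 3
      with es obtain z where "adjacent G x z" "adjacent G z y" "z \<in> verts G"
        unfolding adjacent_def by auto
      with cross[of x z] cross[of z y] side XY xy show ?thesis by blast
    qed
  qed
  with cross have "adjacent G x y \<longleftrightarrow> (x \<in> X \<longleftrightarrow> y \<in> Y)" if "x \<in> verts G" "y \<in> verts G" for x y
    using that by metis
  with that XY show ?thesis .
qed

section \<open>Components of a multigraph without loops\<close>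

locale loopfree =
  fixes G :: "('v, 'e) multigraph"
  assumes ends_wf: "e \<in> edges G \<Longrightarrow> \<exists>x \<in> verts G. \<exists>y \<in> verts G. x \<noteq> y \<and> ends G e = {x, y}"
begin

lemma adjacent_verts:
  assumes "adjacent G x y"
  shows "x \<in> verts G" "y \<in> verts G" "x \<noteq> y"
  using assms ends_wf unfolding adjacent_def by (fastforce simp: doubleton_eq_iff)+

lemma walk_append: "walk G x es y \<Longrightarrow> walk G y fs z \<Longrightarrow> walk G x (es @ fs) z"
  by (induction es arbitrary: x) auto

lemma reachable_adjacent:
  assumes "reachable G x y" "adjacent G y z"
  shows "reachable G x z"
  using assms adjacent_imp_reachable[OF assms(2)] adjacent_verts[OF assms(2)] walk_append
  unfolding reachable_def by blast

lemma component_edges_wf: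
  assumes "C \<in> components G" "e \<in> edges C"
  shows "\<exists>x \<in> verts C. \<exists>y \<in> verts C. x \<noteq> y \<and> ends C e = {x, y}"
  using assms ends_wf unfolding components_def induced_subgraph_def by fastforce

lemma adjacent_component:
  assumes "C \<in> components G" "x \<in> verts C" "y \<in> verts C"
  shows "adjacent C x y \<longleftrightarrow> adjacent G x y"
proof -
  have "ends G e \<subseteq> verts C \<longrightarrow> (e \<in> edges C \<longleftrightarrow> e \<in> edges G)" "ends C = ends G" for e
    using assms(1) unfolding components_def induced_subgraph_def by auto
  with assms(2,3) show ?thesis unfolding adjacent_def by (metis empty_subsetI insert_subset)
qed

lemma component_closed:
  assumes "C \<in> components G" "x \<in> verts C" "adjacent G x y"
  shows "y \<in> verts C"
  using assms reachable_adjacent unfolding components_def induced_subgraph_def by auto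

lemma in_some_component:
  assumes "x \<in> verts G"
  obtains C where "C \<in> components G" "x \<in> verts C"
proof
  show "induced_subgraph G {y. reachable G x y} \<in> components G"
    unfolding components_def using assms by blast
  show "x \<in> verts (induced_subgraph G {y. reachable G x y})"
    unfolding induced_subgraph_def using reachable_refl[OF assms] by simp
qed

text \<open>One set describes both sides: adjacency within a component becomes a difference in
  membership, which reduces the two closure facts below to propositional logic.\<close>

lemma component_sides:
  assumes "C \<in> components G" "bipartite C" "diameter C = enat 2"
  obtains X where "\<And>x y. x \<in> verts C \<Longrightarrow> y \<in> verts C \<Longrightarrow> adjacent G x y \<longleftrightarrow> (x \<in> X \<longleftrightarrow> y \<notin> X)"
proof -
  obtain X Y where XY: "X \<union> Y = verts C" "X \<inter> Y = {}"
    and adj: "\<And>x y. x \<in> verts C \<Longrightarrow> y \<in> verts C \<Longrightarrow> adjacent C x y \<longleftrightarrow> (x \<in> X \<longleftrightarrow> y \<in> Y)"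
    using bipartite_diameter_2_complete assms(2,3) by blast
  have "y \<in> Y \<longleftrightarrow> y \<notin> X" if "y \<in> verts C" for y
    using XY that by blast
  with adj have "adjacent G x y \<longleftrightarrow> (x \<in> X \<longleftrightarrow> y \<notin> X)" if "x \<in> verts C" "y \<in> verts C" for x y
    using adjacent_component[OF assms(1)] that by metis
  with that show ?thesis .
qed

context
  assumes comp: "\<And>C. C \<in> components G \<Longrightarrow> bipartite C \<and> diameter C = enat 2"
begin

text \<open>Each edge changes sides, so the ends of a path of length two share a side.\<close>

lemma no_triangle:
  assumes "adjacent G x y" "adjacent G y z"
  shows "\<not> adjacent G x z"
proof -
  obtain C where C: "C \<in> components G" "x \<in> verts C"
    using in_some_component adjacent_verts(1) assms(1) .
  moreover have "y \<in> verts C" using component_closed[OF C assms(1)] .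
  moreover have "z \<in> verts C" using component_closed[OF C(1) _ assms(2)] calculation by blast
  moreover obtain X where
    "\<And>x y. x \<in> verts C \<Longrightarrow> y \<in> verts C \<Longrightarrow> adjacent G x y \<longleftrightarrow> (x \<in> X \<longleftrightarrow> y \<notin> X)"
    using component_sides C(1) comp[OF C(1)] by metis
  ultimately show ?thesis using assms by metis
qed

text \<open>Three edges change sides three times, and completeness supplies the edge between
  opposite sides. This closure is what makes the sets of differences cosets.\<close>

lemma path_closed:
  assumes "adjacent G x y" "adjacent G y z" "adjacent G z t"
  shows "adjacent G x t"
proof -
  obtain C where C: "C \<in> components G" "x \<in> verts C"
    using in_some_component adjacent_verts(1) assms(1) .
  moreover have "y \<in> verts C" using component_closed[OF C assms(1)] .
  moreover have "z \<in> verts C" using component_closed[OF C(1) _ assms(2)] calculation by blast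
  moreover have "t \<in> verts C" using component_closed[OF C(1) _ assms(3)] calculation by blast
  moreover obtain X where
    "\<And>x y. x \<in> verts C \<Longrightarrow> y \<in> verts C \<Longrightarrow> adjacent G x y \<longleftrightarrow> (x \<in> X \<longleftrightarrow> y \<notin> X)"
    using component_sides C(1) comp[OF C(1)] by metis
  ultimately show ?thesis using assms by metis
qed

end

text \<open>Parallel edges lie in a common component, where the girth excludes them.\<close>

lemma inj_on_ends_of_components:
  assumes "\<And>C. C \<in> components G \<Longrightarrow> girth C > enat 2"
  shows "inj_on (ends G) (edges G)"
proof (rule inj_onI)
  fix e e'
  assume e: "e \<in> edges G" "e' \<in> edges G" "ends G e = ends G e'"
  obtain x y where xy: "x \<in> verts G" "y \<in> verts G" "ends G e = {x, y}"
    using ends_wf[OF e(1)] by blast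
  define C where "C = induced_subgraph G {y. reachable G x y}"
  have C: "C \<in> components G"
    unfolding C_def components_def using xy by blast
  have "adjacent G x y"
    using xy(3) e(1) unfolding adjacent_def by blast
  then have "reachable G x y"
    using adjacent_imp_reachable xy by metis
  then have "ends G e \<subseteq> {y. reachable G x y}"
    using xy reachable_refl by auto
  then have "e \<in> edges C" "e' \<in> edges C"
    using e unfolding C_def induced_subgraph_def by auto
  moreover have "ends C e = ends C e'"
    using e(3) unfolding C_def induced_subgraph_def by simp
  moreover have "inj_on (ends C) (edges C)"
    using component_edges_wf[OF C] assms[OF C] by (metis inj_on_ends_of_girth)
  ultimately show "e = e'"
    by (simp add: inj_on_eq_iff)
qed

end

section \<open>Graphs governed by a residue function\<close>

lemma walk_induced_subgraph:
  assumes "walk (induced_subgraph G X) x es y" "X \<subseteq> verts G"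
  shows "walk G x es y"
  using assms(1)
proof (induction es arbitrary: x)
  case Nil
  with assms(2) show ?case unfolding induced_subgraph_def by auto
next
  case (Cons e es)
  with assms(2) show ?case unfolding induced_subgraph_def by auto
qed

text \<open>Without parallel edges an edge amounts to its set of end points, so a bijection of
  vertices that respects adjacency carries along a bijection of edges.\<close>

lemma isomorphic_graphsI:
  assumes f: "bij_betw f (verts G) (verts H)"
    and "inj_on (ends G) (edges G)" "inj_on (ends H) (edges H)"
    and G: "\<And>e. e \<in> edges G \<Longrightarrow> \<exists>x \<in> verts G. \<exists>y \<in> verts G. ends G e = {x, y}"
    and H: "\<And>e. e \<in> edges H \<Longrightarrow> \<exists>x \<in> verts H. \<exists>y \<in> verts H. ends H e = {x, y}"
    and adj: "\<And>x y. x \<in> verts G \<Longrightarrow> y \<in> verts G \<Longrightarrow> adjacent G x y \<longleftrightarrow> adjacent H (f x) (f y)"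
  shows "isomorphic_graphs G H"
proof -
  have G_ends: "ends G e \<subseteq> verts G" if "e \<in> edges G" for e
    using G[OF that] by auto
  have "(`) f ` ends G ` edges G = ends H ` edges H"
  proof (intro equalityI subsetI)
    fix S assume "S \<in> (`) f ` ends G ` edges G"
    then obtain e where e: "e \<in> edges G" "S = f ` ends G e" by blast
    obtain x y where xy: "x \<in> verts G" "y \<in> verts G" "ends G e = {x, y}"
      using G[OF e(1)] by blast
    with e(1) have "adjacent G x y" unfolding adjacent_def by blast
    with adj xy have "adjacent H (f x) (f y)" by blast
    then show "S \<in> ends H ` edges H"
      using e xy unfolding adjacent_def by force
  next
    fix S assume "S \<in> ends H ` edges H"
    then obtain e where e: "e \<in> edges H" "S = ends H e" by blast
    obtain x' y' where xy': "x' \<in> verts H" "y' \<in> verts H" "ends H e = {x', y'}"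
      using H[OF e(1)] by blast
    obtain x y where xy: "x \<in> verts G" "y \<in> verts G" "x' = f x" "y' = f y"
      using xy'(1,2) f unfolding bij_betw_def by blast
    have "adjacent H (f x) (f y)"
      using e xy xy' unfolding adjacent_def by blast
    with adj xy have "adjacent G x y" by blast
    then obtain d where "d \<in> edges G" "ends G d = {x, y}"
      unfolding adjacent_def by blast
    then show "S \<in> (`) f ` ends G ` edges G"
      using e xy xy' by (intro image_eqI[of _ _ "{x, y}"]) (auto intro!: image_eqI[of _ _ d])
  qed
  moreover have "inj_on ((`) f) (ends G ` edges G)"
    using inj_on_image[of f "ends G ` edges G"] f G_ends
    by (intro inj_on_image) (auto simp: bij_betw_def intro: inj_on_subset)
  ultimately have "bij_betw ((`) f) (ends G ` edges G) (ends H ` edges H)"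
    by (simp add: bij_betw_def)
  moreover have "bij_betw (ends G) (edges G) (ends G ` edges G)"
    "bij_betw (ends H) (edges H) (ends H ` edges H)"
    using assms(2,3) by (simp_all add: bij_betw_def)
  \<comment> \<open>An edge of G goes to its end points, then to their images, then to the only edge
    of H with these ends.\<close>
  ultimately have bij: "bij_betw (inv_into (edges H) (ends H) \<circ> ((`) f \<circ> ends G)) (edges G) (edges H)"
    by (meson bij_betw_inv_into bij_betw_trans)
  have "ends H ((inv_into (edges H) (ends H) \<circ> ((`) f \<circ> ends G)) e) = f ` ends G e"
    if "e \<in> edges G" for e
  proof -
    have "f ` ends G e \<in> ends H ` edges H"
      using that \<open>(`) f ` ends G ` edges G = ends H ` edges H\<close> by blast
    then show ?thesis by (simp add: f_inv_into_f)
  qed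
  with f bij show ?thesis
    unfolding isomorphic_graphs_def by blast
qed

text \<open>\<open>f\<close> labels the vertices by residues modulo 2m, adjacency means that labels
  differ by m, and \<open>fibre\<close> says that every residue is a label. Simplicity is left to a
  later locale, as the number of components depends on adjacency only.\<close>

locale residue_bipartite = loopfree G
  for G :: "('v, 'e) multigraph" +
  fixes f :: "'v \<Rightarrow> int" and m :: nat
  assumes m_pos: "m > 0"
    and adjacent_iff: "x \<in> verts G \<Longrightarrow> y \<in> verts G \<Longrightarrow>
      adjacent G x y \<longleftrightarrow> 2 * int m dvd f y - f x - int m"
    and fibre: "\<exists>x \<in> verts G. 2 * int m dvd f x - r"
begin

text \<open>Every edge adds m to the label modulo 2m.\<close>

lemma walk_residue: "walk G x es y \<Longrightarrow> 2 * int m dvd f y - f x - int (length es) * int m"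
proof (induction es arbitrary: x)
  case Nil
  then show ?case by simp
next
  case (Cons e es)
  then obtain z where z: "ends G e = {x, z}" "walk G z es y" "x \<in> verts G" "e \<in> edges G"
    by auto
  then have "adjacent G x z"
    unfolding adjacent_def by blast
  then have "2 * int m dvd f z - f x - int m"
    using adjacent_iff z(3) walk_start[OF z(2)] by blast
  then have "2 * int m dvd (f z - f x - int m) + (f y - f z - int (length es) * int m)"
    using Cons.IH[OF z(2)] by (rule dvd_add)
  then show ?case by (simp add: algebra_simps)
qed

text \<open>Labels congruent modulo m differ by an odd multiple of m, which gives an edge, or by an
  even one, which gives a path of length two through a vertex labelled
  \<open>f x + m\<close>.\<close>

lemma reachable_iff:
  assumes "x \<in> verts G"
  shows "reachable G x y \<longleftrightarrow> y \<in> verts G \<and> int m dvd f y - f x"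
proof
  assume "reachable G x y"
  then obtain es where es: "walk G x es y" unfolding reachable_def by blast
  have "int m dvd f y - f x - int (length es) * int m"
    using walk_residue[OF es] dvd_mult_right by blast
  then have "int m dvd f y - f x"
    using dvd_add_right_iff[of "int m" "- (int (length es) * int m)" "f y - f x"] by simp
  with walk_end[OF es] show "y \<in> verts G \<and> int m dvd f y - f x" by blast
next
  assume y: "y \<in> verts G \<and> int m dvd f y - f x"
  then obtain k where k: "f y - f x = int m * k" by auto
  obtain z where z: "z \<in> verts G" "2 * int m dvd f z - (f x + int m)"
    using fibre by blast
  then have xz: "adjacent G x z"
    using adjacent_iff[of x z] assms by (simp add: algebra_simps)
  show "reachable G x y"
  proof (cases "even k")
    case True
    then obtain l where "f y - f x = 2 * int m * l" using k by auto
    then have "2 * int m dvd f y - f x" by simp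
    then have "2 * int m dvd f y - f x - (f z - (f x + int m)) - 2 * int m"
      using dvd_diff[OF dvd_diff[OF _ z(2)] dvd_refl] by blast
    then have "2 * int m dvd f y - f z - int m" by (simp add: algebra_simps)
    then have "adjacent G z y" using adjacent_iff z y by blast
    with xz show ?thesis
      using reachable_adjacent reachable_refl[OF assms] by metis
  next
    case False
    then obtain l where "k = 2 * l + 1" by (auto elim: oddE)
    then have "f y - f x - int m = 2 * int m * l" using k by (simp add: algebra_simps)
    then have "adjacent G x y" using adjacent_iff assms y by auto
    then show ?thesis using adjacent_imp_reachable assms y by metis
  qed
qed

text \<open>Indexed by a residue instead of a base vertex, so that the components are parametrised
  by residues modulo m.\<close>

definition component :: "int \<Rightarrow> ('v, 'e) multigraph" where
  "component r = induced_subgraph G {y \<in> verts G. int m dvd f y - r}"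

lemma verts_component: "verts (component r) = {y \<in> verts G. int m dvd f y - r}"
  unfolding component_def induced_subgraph_def by simp

lemma fibre_component:
  assumes "int m dvd s - r"
  obtains x where "x \<in> verts (component r)" "2 * int m dvd f x - s"
proof -
  obtain x where x: "x \<in> verts G" "2 * int m dvd f x - s" using fibre by blast
  then have "int m dvd (f x - s) + (s - r)"
    using assms by (intro dvd_add) (auto dest: dvd_mult_right)
  with x that show ?thesis by (simp add: verts_component)
qed

lemma component_cong:
  assumes "int m dvd s - r"
  shows "component s = component r"
proof -
  have "int m dvd x - s \<longleftrightarrow> int m dvd x - r" for x
    using dvd_add_left_iff[OF assms, of "x - s"] by simp
  then show ?thesis unfolding component_def by simp
qed

lemma components_eq: "components G = component ` {0..<int m}"
proof -
  have "{y. reachable G x y} = {y \<in> verts G. int m dvd f y - f x}" if "x \<in> verts G" for x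
    using reachable_iff[OF that] by blast
  then have "components G = (\<lambda>x. component (f x)) ` verts G"
    unfolding components_def component_def by (intro image_cong refl) metis
  also have "\<dots> = component ` {0..<int m}"
  proof (intro equalityI subsetI)
    fix C assume "C \<in> (\<lambda>x. component (f x)) ` verts G"
    then obtain x where "C = component (f x)" by blast
    also have "\<dots> = component (f x mod int m)"
      by (rule component_cong) (simp add: mod_eq_dvd_iff[symmetric])
    finally show "C \<in> component ` {0..<int m}" using m_pos by auto
  next
    fix C assume "C \<in> component ` {0..<int m}"
    then obtain r where C: "C = component r" by blast
    obtain x where "x \<in> verts (component r)" using fibre_component[of r r] by auto
    then have "x \<in> verts G" "component (f x) = component r"
      using component_cong by (auto simp: verts_component)
    with C show "C \<in> (\<lambda>x. component (f x)) ` verts G" by (metis imageI)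
  qed
  finally show ?thesis .
qed

text \<open>Each class of labels modulo m is nonempty by \<open>fibre\<close>, and a common vertex
  forces two residues to agree.\<close>

lemma card_components: "card (components G) = m"
proof -
  have "inj_on component {0..<int m}"
  proof (rule inj_onI)
    fix r s assume rs: "r \<in> {0..<int m}" "s \<in> {0..<int m}" "component r = component s"
    obtain x where "x \<in> verts (component r)" using fibre_component[of r r] by auto
    moreover from this rs(3) have "x \<in> verts (component s)" by simp
    ultimately have "int m dvd (f x - r) - (f x - s)"
      unfolding verts_component by (metis (mono_tags, lifting) dvd_diff mem_Collect_eq)
    then have "s mod int m = r mod int m" by (simp add: mod_eq_dvd_iff)
    with rs show "r = s" by simp
  qed
  then show ?thesis unfolding components_eq by (simp add: card_image)
qed

lemma component_in_components: "component r \<in> components G"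
proof -
  have "component (r mod int m) = component r"
    by (rule component_cong) (simp add: mod_eq_dvd_iff[symmetric])
  moreover have "r mod int m \<in> {0..<int m}" using m_pos by simp
  ultimately show ?thesis unfolding components_eq by (metis imageI)
qed

lemma adjacent_component_iff:
  assumes "x \<in> verts (component r)" "y \<in> verts (component r)"
  shows "adjacent (component r) x y \<longleftrightarrow> 2 * int m dvd f y - f x - int m"
  using assms adjacent_component[OF component_in_components assms] adjacent_iff
  by (simp add: verts_component)

text \<open>Within a component \<open>f x - r\<close> is a multiple of m; the quotient is even on
  one side and odd on the other.\<close>

lemma component_side:
  assumes "x \<in> verts (component r)"
  shows "2 * int m dvd f x - r \<longleftrightarrow> \<not> 2 * int m dvd f x - r - int m"
proof -
  obtain k where k: "f x - r = int m * k"
    using assms by (auto simp: verts_component)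
  have "2 * int m dvd f x - r \<longleftrightarrow> even k"
    using m_pos unfolding k by (subst mult.commute) simp
  moreover have "f x - r - int m = int m * (k - 1)"
    using k by (simp add: algebra_simps)
  then have "2 * int m dvd f x - r - int m \<longleftrightarrow> even (k - 1)"
    using m_pos by (simp only: mult.commute[of 2]) simp
  ultimately show ?thesis by auto
qed

text \<open>The side of a vertex is decided by whether its label is r or r + m modulo 2m, and
  adjacent labels differ by m.\<close>

lemma same_side_iff:
  assumes "x \<in> verts (component r)" "y \<in> verts (component r)"
  shows "adjacent (component r) x y \<longleftrightarrow> (2 * int m dvd f x - r \<longleftrightarrow> \<not> 2 * int m dvd f y - r)"
proof -
  \<comment> \<open>Recentring the component at x makes \<open>component_side\<close> speak of the
    difference of the two labels.\<close>
  have y: "y \<in> verts (component (f x))"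
  proof -
    have "int m dvd (f y - r) - (f x - r)"
      using assms unfolding verts_component by (metis (mono_tags, lifting) dvd_diff mem_Collect_eq)
    with assms show ?thesis by (simp add: verts_component)
  qed
  have "2 * int m dvd f y - f x \<longleftrightarrow> (2 * int m dvd f x - r \<longleftrightarrow> 2 * int m dvd f y - r)"
  proof (cases "2 * int m dvd f x - r")
    case True
    with dvd_add_right_iff[OF True, of "f y - f x"] show ?thesis by simp
  next
    case False
    then have x: "2 * int m dvd f x - r - int m"
      using component_side assms(1) by blast
    have "2 * int m dvd f y - f x \<longleftrightarrow> 2 * int m dvd f y - r - int m"
      using dvd_add_right_iff[OF x, of "f y - f x"] by (simp add: algebra_simps)
    with False component_side assms(2) show ?thesis by blast
  qed
  with component_side[OF y] adjacent_component_iff[OF assms] show ?thesis by blast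
qed

lemma component_edge:
  assumes "e \<in> edges (component r)"
  obtains x y where "x \<in> verts (component r)" "y \<in> verts (component r)"
    "ends (component r) e = {x, y}" "2 * int m dvd f x - r" "\<not> 2 * int m dvd f y - r"
proof -
  obtain x y where xy: "x \<in> verts (component r)" "y \<in> verts (component r)"
    "ends (component r) e = {x, y}"
    using component_edges_wf[OF component_in_components assms] by blast
  with assms have "adjacent (component r) x y" unfolding adjacent_def by blast
  then have "2 * int m dvd f x - r \<longleftrightarrow> \<not> 2 * int m dvd f y - r"
    using same_side_iff xy by blast
  with that[of x y] that[of y x] xy show ?thesis by (auto simp: insert_commute)
qed

text \<open>Vertices on opposite sides are adjacent; vertices on the same side have a common
  neighbour, labelled \<open>f x + m\<close>.\<close>

lemma component_short_walk:
  assumes "x \<in> verts (component r)" "y \<in> verts (component r)"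
  obtains es where "walk (component r) x es y" "length es \<le> 2"
proof (cases "adjacent (component r) x y")
  case True
  then obtain e where "e \<in> edges (component r)" "ends (component r) e = {x, y}"
    unfolding adjacent_def by blast
  with assms have "walk (component r) x [e] y" by auto
  with that[of "[e]"] show ?thesis by simp
next
  case False
  then have same: "2 * int m dvd f x - r \<longleftrightarrow> 2 * int m dvd f y - r"
    using same_side_iff assms by blast
  obtain z where z: "z \<in> verts (component r)" "2 * int m dvd f z - f x - int m"
  proof -
    have "int m dvd f x + int m - r"
      using assms(1) dvd_add[of "int m" "f x - r" "int m"]
      by (simp add: verts_component algebra_simps)
    then obtain z where "z \<in> verts (component r)" "2 * int m dvd f z - (f x + int m)"
      by (rule fibre_component)
    with that show ?thesis by (simp add: diff_diff_eq)
  qed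
  then have "adjacent (component r) x z"
    using adjacent_component_iff assms by blast
  moreover from this same z assms have "adjacent (component r) z y"
    using same_side_iff by blast
  ultimately obtain e e' where "e \<in> edges (component r)" "ends (component r) e = {x, z}"
    "e' \<in> edges (component r)" "ends (component r) e' = {z, y}"
    unfolding adjacent_def by blast
  with assms z have "walk (component r) x [e, e'] y" by auto
  with that[of "[e, e']"] show ?thesis by simp
qed

lemma connected_component: "connected_graph (component r)"
proof -
  have "int m dvd r - r" by simp
  then obtain x where "x \<in> verts (component r)"
    by (rule fibre_component)
  moreover have "reachable (component r) x y"
    if "x \<in> verts (component r)" "y \<in> verts (component r)" for x y
    using component_short_walk[OF that] unfolding reachable_def by blast
  ultimately show ?thesis
    unfolding connected_graph_def by blast
qed

lemma bipartite_component: "bipartite (component r)"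
proof -
  define X where "X = {x \<in> verts (component r). 2 * int m dvd f x - r}"
  have "\<exists>a \<in> X. \<exists>b \<in> verts (component r) - X. ends (component r) e = {a, b}"
    if e: "e \<in> edges (component r)" for e
  proof -
    obtain x y where "x \<in> verts (component r)" "y \<in> verts (component r)"
      "ends (component r) e = {x, y}" "2 * int m dvd f x - r" "\<not> 2 * int m dvd f y - r"
      by (rule component_edge[OF e])
    then have "x \<in> X" "y \<in> verts (component r) - X" "ends (component r) e = {x, y}"
      by (simp_all add: X_def)
    then show ?thesis by blast
  qed
  moreover have "X \<union> (verts (component r) - X) = verts (component r)"
    unfolding X_def by blast
  ultimately show ?thesis
    unfolding bipartite_def by (metis Diff_disjoint)
qed

end

text \<open>Three vertices per label give the degree bound and a 4-cycle; the label shifts in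
  \<open>translation\<close> permute the components and make them isomorphic.\<close>

locale simple_residue_bipartite = residue_bipartite +
  assumes inj_ends: "inj_on (ends G) (edges G)"
    and finite_edges: "finite (edges G)"
    and fibre_3: "\<exists>x \<in> verts G. \<exists>y \<in> verts G. \<exists>z \<in> verts G. distinct [x, y, z] \<and>
      2 * int m dvd f x - r \<and> 2 * int m dvd f y - r \<and> 2 * int m dvd f z - r"
    and translation: "\<exists>T. bij_betw T (verts G) (verts G) \<and>
      (\<forall>x \<in> verts G. 2 * int m dvd f (T x) - f x - t)"
begin

lemma inj_ends_component: "inj_on (ends (component r)) (edges (component r))"
  using inj_ends unfolding component_def induced_subgraph_def by (auto intro: inj_on_subset)

lemma component_fibre_3:
  assumes "int m dvd s - r"
  obtains x y z where "x \<in> verts (component r)" "y \<in> verts (component r)"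
    "z \<in> verts (component r)" "x \<noteq> y" "x \<noteq> z" "y \<noteq> z"
    "2 * int m dvd f x - s" "2 * int m dvd f y - s" "2 * int m dvd f z - s"
proof -
  obtain x y z where xyz: "x \<in> verts G" "y \<in> verts G" "z \<in> verts G" "distinct [x, y, z]"
    "2 * int m dvd f x - s" "2 * int m dvd f y - s" "2 * int m dvd f z - s"
    using fibre_3 by blast
  have "v \<in> verts (component r)" if "v \<in> verts G" "2 * int m dvd f v - s" for v
    using that component_cong[OF assms] verts_component[of s] by (auto dest: dvd_mult_right)
  with xyz that[of x y z] show ?thesis by simp
qed

lemma opposite_fibre_3:
  assumes "x \<in> verts (component r)"
  obtains a b c where "a \<in> verts (component r)" "b \<in> verts (component r)"
    "c \<in> verts (component r)" "a \<noteq> b" "a \<noteq> c" "b \<noteq> c" "adjacent (component r) x a"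
    "adjacent (component r) x b" "adjacent (component r) x c"
proof -
  have "int m dvd f x + int m - r"
    using assms dvd_add[of "int m" "f x - r" "int m"] by (simp add: verts_component algebra_simps)
  then obtain a b c where "a \<in> verts (component r)" "b \<in> verts (component r)"
    "c \<in> verts (component r)" "a \<noteq> b" "a \<noteq> c" "b \<noteq> c"
    "2 * int m dvd f a - (f x + int m)" "2 * int m dvd f b - (f x + int m)"
    "2 * int m dvd f c - (f x + int m)"
    by (rule component_fibre_3)
  with that show ?thesis
    using adjacent_component_iff[OF assms] by (simp add: diff_diff_eq)
qed

text \<open>Two distinct vertices with the same label are not adjacent, which gives the lower
  bound.\<close>

lemma diameter_component: "diameter (component r) = enat 2"
proof (rule antisym)
  show "diameter (component r) \<le> enat 2"
    unfolding diameter_def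
  proof (intro SUP_least)
    fix x y assume "x \<in> verts (component r)" "y \<in> verts (component r)"
    then obtain es where "walk (component r) x es y" "length es \<le> 2"
      by (rule component_short_walk)
    then show "distance (component r) x y \<le> enat 2"
      using distance_le_walk by (metis enat_ord_simps(1) order_trans)
  qed
  have "int m dvd r - r" by simp
  then obtain x y z where xy: "x \<in> verts (component r)" "y \<in> verts (component r)"
    "z \<in> verts (component r)" "x \<noteq> y" "x \<noteq> z" "y \<noteq> z"
    "2 * int m dvd f x - r" "2 * int m dvd f y - r" "2 * int m dvd f z - r"
    by (rule component_fibre_3)
  then have "\<not> adjacent (component r) x y" using same_side_iff by blast
  then have "2 \<le> length es" if "walk (component r) x es y" for es
    using that xy(4) unfolding adjacent_def by (cases es; cases "tl es") auto
  then have "enat 2 \<le> distance (component r) x y"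
    unfolding distance_def by (intro INF_greatest) simp
  then show "enat 2 \<le> diameter (component r)"
    using distance_le_diameter[OF xy(1,2)] by order
qed

text \<open>Two vertices on each side form a 4-cycle. A closed path has even length, because the
  label returns modulo 2m, and length two would need a pair of parallel edges.\<close>

lemma girth_component: "girth (component r) = enat (2 * 2)"
proof (rule antisym)
  have "int m dvd r - r" by simp
  then obtain x x' z where x: "x \<in> verts (component r)" "x' \<in> verts (component r)"
    "z \<in> verts (component r)" "x \<noteq> x'" "x \<noteq> z" "x' \<noteq> z"
    "2 * int m dvd f x - r" "2 * int m dvd f x' - r" "2 * int m dvd f z - r"
    by (rule component_fibre_3)
  obtain y y' where y: "y \<in> verts (component r)" "y' \<in> verts (component r)" "y \<noteq> y'"
    "adjacent (component r) x y" "adjacent (component r) x y'"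
    using opposite_fibre_3 x(1) by blast
  have "adjacent (component r) y x'" "adjacent (component r) x' y'"
    using x y same_side_iff by blast+
  note adj = y(4) this adjacent_sym[OF y(5)]
  obtain e1 where e1: "e1 \<in> edges (component r)" "ends (component r) e1 = {x, y}"
    using adj(1) by (rule adjacentE)
  obtain e2 where e2: "e2 \<in> edges (component r)" "ends (component r) e2 = {y, x'}"
    using adj(2) by (rule adjacentE)
  obtain e3 where e3: "e3 \<in> edges (component r)" "ends (component r) e3 = {x', y'}"
    using adj(3) by (rule adjacentE)
  obtain e4 where e4: "e4 \<in> edges (component r)" "ends (component r) e4 = {y', x}"
    using adj(4) by (rule adjacentE)
  note e = e1 e2 e3 e4
  have "e1 \<noteq> e2" "e2 \<noteq> e3" "e3 \<noteq> e4"
    using e x(4) y(3) by (auto simp: doubleton_eq_iff)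
  moreover have "walk (component r) x [e1, e2, e3, e4] x"
    using x y by (intro walk_ConsI[OF e1] walk_ConsI[OF e2] walk_ConsI[OF e3] walk_ConsI[OF e4]) simp_all
  ultimately have "reduced_closed_path (component r) [e1, e2, e3, e4]"
    unfolding reduced_closed_path_def by auto
  moreover have "length [e1, e2, e3, e4] = 2 * 2" by simp
  ultimately show "girth (component r) \<le> enat (2 * 2)"
    by (metis girth_le)
  have "4 \<le> length es" if es: "reduced_closed_path (component r) es" for es
  proof -
    obtain x where x: "walk (component r) x es x" "es \<noteq> []" "successively (\<noteq>) es"
      using es unfolding reduced_closed_path_def by blast
    have "walk G x es x"
      using x(1) walk_induced_subgraph[of G] unfolding component_def by blast
    from walk_residue[OF this] have "2 * int m dvd int (length es) * int m" by simp
    then have "even (length es)" using m_pos by simp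
    moreover have "length es \<noteq> 2"
    proof
      assume "length es = 2"
      then obtain e e' where e: "es = [e, e']" by (auto simp: length_Suc_conv numeral_2_eq_2)
      with x have "e \<noteq> e'" "e \<in> edges (component r)" "e' \<in> edges (component r)"
        "ends (component r) e = ends (component r) e'"
        by (auto simp: insert_commute)
      then show False using inj_ends_component by (meson inj_onD)
    qed
    moreover have "length es \<noteq> 0" using x(2) by simp
    ultimately show ?thesis by presburger
  qed
  then show "enat (2 * 2) \<le> girth (component r)"
    unfolding girth_def by (intro INF_greatest) simp
qed

text \<open>Edges to three different neighbours are different.\<close>

lemma degree_component:
  assumes x: "x \<in> verts (component r)"
  shows "degree (component r) x \<ge> 3"
proof -
  obtain a b c where abc: "a \<noteq> b" "a \<noteq> c" "b \<noteq> c" "adjacent (component r) x a"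
    "adjacent (component r) x b" "adjacent (component r) x c"
    using opposite_fibre_3[OF x] by metis
  then obtain d e g where deg: "{d, e, g} \<subseteq> {e \<in> edges (component r). x \<in> ends (component r) e}"
    "ends (component r) d = {x, a}" "ends (component r) e = {x, b}" "ends (component r) g = {x, c}"
    unfolding adjacent_def by (smt (verit) empty_subsetI insert_iff insert_subset mem_Collect_eq)
  with abc have "distinct [d, e, g]" by (auto simp: doubleton_eq_iff)
  then have "3 = card {d, e, g}" by simp
  also have "\<dots> \<le> card {e \<in> edges (component r). x \<in> ends (component r) e}"
    using finite_edges deg(1) unfolding component_def induced_subgraph_def
    by (intro card_mono) auto
  finally show ?thesis unfolding degree_def by simp
qed

text \<open>Shifting labels by s - r carries the class of r to that of s and preserves differences
  of labels.\<close>

lemma isomorphic_components: "isomorphic_graphs (component r) (component s)"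
proof -
  obtain T where T: "bij_betw T (verts G) (verts G)"
    "\<And>x. x \<in> verts G \<Longrightarrow> 2 * int m dvd f (T x) - f x - (s - r)"
    using translation by metis
  have iff: "T x \<in> verts (component s) \<longleftrightarrow> x \<in> verts (component r)" if "x \<in> verts G" for x
  proof -
    have "int m dvd f (T x) - f x - (s - r)"
      using T(2)[OF that] by (rule dvd_mult_right)
    then have "int m dvd f (T x) - s \<longleftrightarrow> int m dvd f x - r"
      using dvd_add_right_iff[of "int m" "f (T x) - f x - (s - r)" "f x - r"]
      by (simp add: algebra_simps)
    with that T(1) show ?thesis unfolding verts_component by (auto simp: bij_betw_def)
  qed
  have "T ` verts (component r) = verts (component s)"
  proof (intro equalityI subsetI)
    fix y assume y: "y \<in> verts (component s)"
    then have "y \<in> T ` verts G" using T(1) by (simp add: verts_component bij_betw_def)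
    with y iff show "y \<in> T ` verts (component r)" by blast
  next
    fix y assume "y \<in> T ` verts (component r)"
    then show "y \<in> verts (component s)" using iff by (auto simp: verts_component)
  qed
  then have bij: "bij_betw T (verts (component r)) (verts (component s))"
    using T(1) unfolding bij_betw_def verts_component by (auto intro: inj_on_subset)
  have "adjacent (component r) x y \<longleftrightarrow> adjacent (component s) (T x) (T y)"
    if xy: "x \<in> verts (component r)" "y \<in> verts (component r)" for x y
  proof -
    have G: "x \<in> verts G" "y \<in> verts G" using xy by (auto simp: verts_component)
    have "2 * int m dvd (f (T y) - f y - (s - r)) - (f (T x) - f x - (s - r))"
      using T(2) G by (metis dvd_diff)
    then have "2 * int m dvd f (T y) - f (T x) - int m \<longleftrightarrow> 2 * int m dvd f y - f x - int m"
      using dvd_add_right_iff[of "2 * int m" "(f (T y) - f y - (s - r)) - (f (T x) - f x - (s - r))"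
        "f y - f x - int m"]
      by (simp add: algebra_simps)
    with xy iff G show ?thesis by (simp add: adjacent_component_iff)
  qed
  with bij inj_ends_component show ?thesis
    using component_edges_wf[OF component_in_components]
    by (intro isomorphic_graphsI[of T]) blast+
qed

end

section \<open>Residues modulo an even number\<close>

text \<open>Closure under differences already yields 0, negatives and sums, so this is division with
  remainder by the least positive element of a subgroup.\<close>

lemma int_subgroup_eq_multiples:
  fixes H :: "int set"
  assumes diff: "\<And>a b. a \<in> H \<Longrightarrow> b \<in> H \<Longrightarrow> a - b \<in> H" and n: "n \<in> H" "n > 0"
  obtains g where "g > 0" "\<And>a. a \<in> H \<longleftrightarrow> g dvd a"
proof -
  define k where "k = (LEAST k. k > 0 \<and> int k \<in> H)"
  have "nat n > 0 \<and> int (nat n) \<in> H" using n by simp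
  then have k: "k > 0" "int k \<in> H"
    unfolding k_def by (metis (mono_tags, lifting) LeastI)+
  have zero: "0 \<in> H" using diff[OF n(1) n(1)] by simp
  have add: "a + b \<in> H" if "a \<in> H" "b \<in> H" for a b
    using diff[OF that(1) diff[OF zero that(2)]] by simp
  have nat_mult: "int i * int k \<in> H" for i
    by (induction i) (use zero add k(2) in \<open>auto simp: algebra_simps\<close>)
  have mult: "i * int k \<in> H" for i
  proof (cases "i \<ge> 0")
    case True
    then show ?thesis using nat_mult[of "nat i"] by simp
  next
    case False
    then show ?thesis using diff[OF zero nat_mult[of "nat (- i)"]] by simp
  qed
  have "int k dvd a" if "a \<in> H" for a
  proof -
    have "a mod int k \<in> H"
      using diff[OF that mult[of "a div int k"]] by (simp add: minus_div_mult_eq_mod)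
    moreover have "a mod int k < int k" "a mod int k \<ge> 0" using k(1) by simp_all
    ultimately have "nat (a mod int k) = 0"
      using not_less_Least[of "nat (a mod int k)" "\<lambda>k. k > 0 \<and> int k \<in> H"]
      unfolding k_def[symmetric] by (auto simp: nat_less_iff)
    with \<open>a mod int k \<ge> 0\<close> show ?thesis by (simp add: dvd_eq_mod_eq_0)
  qed
  moreover have "a \<in> H" if "int k dvd a" for a
    using that mult by (auto simp: dvd_def mult.commute)
  ultimately show ?thesis using that[of "int k"] k(1) by auto
qed

text \<open>
  The neighbours of \<open>0\<close> on the same level form a coset \<open>a + H\<close> of a subgroup \<open>H\<close>; absence of
  triangles makes \<open>a\<close> an element of order two modulo \<open>H\<close>.
\<close>

lemma residue_structure:
  fixes R :: "bool \<Rightarrow> bool \<Rightarrow> int \<Rightarrow> bool" and n :: int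
  assumes n: "n > 0"
    and periodic: "\<And>s t a. R s t (a + n) \<longleftrightarrow> R s t a"
    and sym: "\<And>s t a. R s t a \<Longrightarrow> R t s (- a)"
    and no_triangle: "\<And>s t r a b. R s t a \<Longrightarrow> R t r b \<Longrightarrow> \<not> R s r (a + b)"
    and path: "\<And>s t r v a b c. R s t a \<Longrightarrow> R t r b \<Longrightarrow> R r v c \<Longrightarrow> R s v (a + b + c)"
    and level: "R s0 s0 a0" and cross: "R True False q"
  obtains m where "m > 0" "2 * m dvd n" "\<And>s a. R s s a \<longleftrightarrow> 2 * m dvd a - m"
    "\<And>a. R True False a \<longleftrightarrow> 2 * m dvd a - q"
proof -
  \<comment> \<open>A step across, one on the other level and the step back: q cancels, so both
    levels have the same differences.\<close>
  have TF: "R False False a" if "R True True a" for a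
    using path[OF path[OF sym[OF cross] that cross] sym[OF cross] cross]
      path[OF sym[OF cross] that cross] by simp
  have FT: "R True True a" if "R False False a" for a
    using path[OF cross that sym[OF cross]] by simp
  obtain a where a: "R True True a"
    using level FT by (cases s0) auto
  define H where "H = {d. R True True (a + d)}"
  have "d - e \<in> H" if "d \<in> H" "e \<in> H" for d e
  proof -
    have "a + d + - (a + e) + a = a + (d - e)" by simp
    with path[OF _ sym a, of True True "a + d" "a + e"] that show ?thesis
      unfolding H_def by (metis mem_Collect_eq)
  qed
  moreover have "n \<in> H" using periodic a by (simp add: H_def)
  ultimately obtain g where g: "g > 0" "\<And>d. d \<in> H \<longleftrightarrow> g dvd d"
    using int_subgroup_eq_multiples n by metis
  \<comment> \<open>Three steps a give the difference a + 2a, while the absence of triangles forbids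
    a + a.\<close>
  have "2 * a \<in> H" using path[OF a a a] by (simp add: H_def)
  moreover have "a \<notin> H" using no_triangle[OF a a] by (simp add: H_def)
  ultimately have ga: "g dvd 2 * a" "\<not> g dvd a" using g(2) by simp_all
  then have "even g"
    using coprime_dvd_mult_right_iff[of g 2 a] by (auto simp: coprime_right_2_iff_odd)
  then obtain m where m: "g = 2 * m" by blast
  with ga(1) obtain k where k: "a = m * k" by auto
  have "odd k" using ga(2) unfolding m k by (auto elim!: evenE)
  then obtain l where "k = 2 * l + 1" by (rule oddE)
  then have "a - m = 2 * m * l" using k by (simp add: algebra_simps)
  then have am: "2 * m dvd a - m" by simp
  have T: "R True True b \<longleftrightarrow> 2 * m dvd b - m" for b
  proof -
    have "R True True b \<longleftrightarrow> b - a \<in> H" by (simp add: H_def)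
    also have "\<dots> \<longleftrightarrow> 2 * m dvd (b - a) + (a - m)"
      unfolding g(2) m using am by (simp only: dvd_add_left_iff)
    finally show ?thesis by simp
  qed
  have "R True False b \<longleftrightarrow> 2 * m dvd b - q" for b
  proof -
    \<comment> \<open>Following a cross step by -q and then a turns it into a level step; following
      that by -a and then q undoes this.\<close>
    have "R True False b \<longleftrightarrow> R True True (a + (b - q))"
    proof
      assume "R True False b"
      from path[OF this sym[OF cross] a] show "R True True (a + (b - q))"
        by (simp add: algebra_simps)
    next
      assume "R True True (a + (b - q))"
      from path[OF this sym[OF a] cross] show "R True False b" by simp
    qed
    also have "\<dots> \<longleftrightarrow> 2 * m dvd b - q" using g(2) m by (simp add: H_def[unfolded set_eq_iff])
    finally show ?thesis .
  qed
  moreover have "R s s b \<longleftrightarrow> 2 * m dvd b - m" for s b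
    using T[of b] TF[of b] FT[of b] by (cases s) auto
  moreover have "2 * m dvd n" using \<open>n \<in> H\<close> g(2) m by simp
  moreover have "m > 0" using g(1) m by simp
  ultimately show ?thesis using that by blast
qed

text \<open>Enumerates the class of r modulo 2m among the residues modulo n, in the form of the list
  in condition (c), and shows that it has l elements whatever r is.\<close>

lemma residue_class_bij:
  fixes m l r n :: int
  assumes "m > 0" and n: "n = 2 * m * l" and "l > 0"
  shows "bij_betw (\<lambda>j. (r + 2 * j * m) mod n) {0..<l} {d \<in> {0..<n}. 2 * m dvd d - r}"
proof (rule bij_betwI')
  fix i j assume ij: "i \<in> {0..<l}" "j \<in> {0..<l}"
  have "(r + 2 * i * m) mod n = (r + 2 * j * m) mod n \<longleftrightarrow> n dvd 2 * m * (i - j)"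
    unfolding mod_eq_dvd_iff by (simp add: algebra_simps)
  also have "\<dots> \<longleftrightarrow> l dvd i - j" using assms by simp
  also have "\<dots> \<longleftrightarrow> i mod l = j mod l" by (simp add: mod_eq_dvd_iff)
  also have "\<dots> \<longleftrightarrow> i = j" using ij by simp
  finally show "(r + 2 * i * m) mod n = (r + 2 * j * m) mod n \<longleftrightarrow> i = j" .
next
  fix j assume "j \<in> {0..<l}"
  have "n > 0" using assms by simp
  have "n dvd (r + 2 * j * m) mod n - (r + 2 * j * m)"
    by (simp add: mod_eq_dvd_iff[symmetric])
  then have "2 * m dvd (r + 2 * j * m) mod n - (r + 2 * j * m)"
    unfolding n by (rule dvd_mult_left)
  then have "2 * m dvd (r + 2 * j * m) mod n - (r + 2 * j * m) + 2 * m * j"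
    by (rule dvd_add) simp
  with \<open>n > 0\<close> show "(r + 2 * j * m) mod n \<in> {d \<in> {0..<n}. 2 * m dvd d - r}"
    by (simp add: algebra_simps)
next
  fix d assume d: "d \<in> {d \<in> {0..<n}. 2 * m dvd d - r}"
  then obtain k where k: "d - r = 2 * m * k" by blast
  have "n dvd 2 * m * (k - k mod l)"
    unfolding n by (intro mult_dvd_mono dvd_refl) (simp add: mod_eq_dvd_iff[symmetric])
  then have "d mod n = (r + 2 * (k mod l) * m) mod n"
    using k unfolding mod_eq_dvd_iff by (simp add: algebra_simps)
  with d show "\<exists>j \<in> {0..<l}. d = (r + 2 * j * m) mod n"
    using \<open>l > 0\<close> by (intro bexI[of _ "k mod l"]) auto
qed

section \<open>Odd multiples of m and sets of signed residues\<close>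

locale half_class =
  fixes n :: nat and m l h :: int
  assumes m_pos: "m > 0" and l_pos: "l > 0" and odd_l: "odd l"
    and n_eq: "int n = 2 * m * l" and h_eq: "h = m * l"
begin

text \<open>The class of m modulo 2m. It is symmetric under negation and contains h = n/2 because l
  is odd.\<close>

definition odd_multiples :: "int set" where
  "odd_multiples = {d \<in> {0..<int n}. 2 * m dvd d - m}"

lemma half_eq: "int n div 2 = h" "2 * h = int n"
  using n_eq h_eq by simp_all

lemma mem_odd_multiples_iff:
  "d \<in> odd_multiples \<longleftrightarrow> (\<exists>i. odd i \<and> d = i * m \<and> 0 < i \<and> i < 2 * l)"
proof
  assume "d \<in> odd_multiples"
  then have d: "0 \<le> d" "d < int n" "2 * m dvd d - m" by (simp_all add: odd_multiples_def)
  then obtain k where "d - m = 2 * m * k" by blast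
  then have k: "d = (2 * k + 1) * m" by (simp add: algebra_simps)
  have "0 \<le> 2 * k + 1" using d(1) m_pos unfolding k by (simp add: zero_le_mult_iff)
  moreover have "2 * k + 1 < 2 * l"
    using d(2) m_pos unfolding k n_eq by (simp add: mult.commute[of _ m] mult.assoc mult.left_commute)
  ultimately show "\<exists>i. odd i \<and> d = i * m \<and> 0 < i \<and> i < 2 * l"
    using k by (intro exI[of _ "2 * k + 1"]) simp
next
  assume "\<exists>i. odd i \<and> d = i * m \<and> 0 < i \<and> i < 2 * l"
  then obtain i where i: "odd i" "d = i * m" "0 < i" "i < 2 * l" by blast
  then obtain k where "i = 2 * k + 1" by (auto elim: oddE)
  then have "d - m = 2 * m * k" using i(2) by (simp add: algebra_simps)
  moreover have "i * m < 2 * l * m" using i(4) m_pos by simp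
  ultimately show "d \<in> odd_multiples"
    using i m_pos unfolding odd_multiples_def n_eq by (simp add: ac_simps)
qed

lemma h_mem: "h \<in> odd_multiples"
  using odd_l l_pos unfolding mem_odd_multiples_iff h_eq by (intro exI[of _ l]) simp

lemma complement_mem:
  assumes "d \<in> odd_multiples"
  shows "int n - d \<in> odd_multiples"
proof -
  obtain i where i: "odd i" "d = i * m" "0 < i" "i < 2 * l"
    using assms mem_odd_multiples_iff by blast
  then have "odd (2 * l - i)" "int n - d = (2 * l - i) * m" by (simp_all add: n_eq algebra_simps)
  with i show ?thesis unfolding mem_odd_multiples_iff by (intro exI[of _ "2 * l - i"]) simp
qed

lemma odd_multiples_bounds: "d \<in> odd_multiples \<Longrightarrow> 0 < d \<and> d < int n"
  using m_pos mem_odd_multiples_iff[of d] by (auto simp: odd_multiples_def)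

definition lower :: "int set" where
  "lower = {i * m | i. 0 < i \<and> odd i \<and> i \<le> int n div (2 * m) - 2}"

text \<open>As l = n/(2m) is odd, an odd number below l is at most l - 2. So the bound in (b)
  selects the odd multiples of m below n/2, one from each pair d, n - d.\<close>

lemma lower_eq: "lower = {d \<in> odd_multiples. d < h}"
proof -
  have "int n div (2 * m) = l" using n_eq m_pos by simp
  moreover have "i \<le> l - 2 \<longleftrightarrow> i < l" if "odd i" for i
    using that odd_l by presburger
  moreover have "i * m < h \<longleftrightarrow> i < l" for i
    using m_pos by (simp add: h_eq mult.commute[of m])
  ultimately show ?thesis
    using l_pos by (auto simp: lower_def mem_odd_multiples_iff)
qed

lemma finite_lower: "finite lower"
  by (rule finite_subset[of _ "{0..<int n}"]) (auto simp: lower_eq odd_multiples_def)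

lemma uminus_mod: "0 < d \<Longrightarrow> d < int n \<Longrightarrow> - d mod int n = int n - d"
  by (simp add: zmod_zminus1_eq_if)

text \<open>Choosing a sign for c means that exactly one of c and n - c is present. Counting each
  pair removes the choice function; n/2 is its own negative and gets a separate clause.\<close>

lemma signed_set_form_iff:
  "signed_set_form n lower M \<longleftrightarrow> set_mset M \<subseteq> odd_multiples \<and> count M h = 1 \<and>
     (\<forall>d \<in> odd_multiples - {h}. count M d + count M (int n - d) = 1)" (is "_ \<longleftrightarrow> ?R")
proof
  assume "signed_set_form n lower M"
  then obtain s where s: "\<And>c. c \<in> lower \<Longrightarrow> s c = c \<or> s c = - c"
    and M: "M = mset_set (insert h ((\<lambda>c. s c mod int n) ` lower))"
    unfolding signed_set_form_def half_eq(1) by blast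
  have s_mod: "s c mod int n = c \<or> s c mod int n = int n - c" if "c \<in> lower" for c
    using s[OF that] that uminus_mod odd_multiples_bounds[of c] by (auto simp: lower_eq)
  let ?I = "(\<lambda>c. s c mod int n) ` lower"
  have I: "?I \<subseteq> odd_multiples - {h}"
  proof clarify
    fix c assume c: "c \<in> lower"
    then have "c \<in> odd_multiples" "c < h" by (simp_all add: lower_eq)
    with s_mod[OF c] complement_mem[of c] half_eq(2)
    show "s c mod int n \<in> odd_multiples - {h}" by auto
  qed
  have count: "count M d = (if d = h \<or> d \<in> ?I then 1 else 0)" for d
    unfolding M using finite_lower by (simp add: count_mset_set')
  have "count M d + count M (int n - d) = 1" if d: "d \<in> odd_multiples" "d \<noteq> h" for d
  proof -
    \<comment> \<open>The member of the pair that lies below n/2 is the one whose sign was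
      chosen.\<close>
    define c where "c = min d (int n - d)"
    have c: "c \<in> lower" "c = d \<or> c = int n - d"
      using d complement_mem[of d] half_eq(2) by (auto simp: c_def lower_eq min_def)
    have I_iff: "x \<in> ?I \<longleftrightarrow> x = s c mod int n" if x: "x = d \<or> x = int n - d" for x
    proof
      assume "x \<in> ?I"
      then obtain c' where c': "c' \<in> lower" "x = s c' mod int n" by blast
      have "c' = c"
        using s_mod[OF c'(1)] c' x c half_eq(2) d by (auto simp: lower_eq)
      with c' show "x = s c mod int n" by simp
    qed (use c in blast)
    have "d \<in> ?I \<longleftrightarrow> d = s c mod int n" "int n - d \<in> ?I \<longleftrightarrow> int n - d = s c mod int n"
      by (rule I_iff, simp)+
    moreover have "int n - d \<noteq> h" "int n - d \<noteq> d" using d(2) half_eq(2) by auto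
    ultimately show ?thesis
      using s_mod[OF c(1)] c(2) d(2) by (auto simp: count)
  qed
  moreover have "set_mset M \<subseteq> odd_multiples"
    unfolding M using I h_mem finite_lower by auto
  ultimately show ?R using count[of h] by simp
next
  assume R: ?R
  \<comment> \<open>If c is absent, the pair condition puts n - c into \<open>M\<close>, so
    membership of c decides its sign.\<close>
  define s where "s c = (if c \<in># M then c else - c)" for c
  \<comment> \<open>Multiplicities are at most one, so \<open>M\<close> is determined by its
    support.\<close>
  have le: "count M d \<le> 1" for d
  proof (cases "d \<in> odd_multiples - {h}")
    case True
    with R have "count M d + count M (int n - d) = 1" by blast
    then show ?thesis by linarith
  next
    case False
    then have "d = h \<or> d \<notin># M" using R by blast
    with R show ?thesis by (auto simp: not_in_iff)
  qed
  have "M = mset_set (set_mset M)"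
  proof (rule multiset_eqI)
    fix d
    have "count M d = 1" if "d \<in># M"
    proof -
      have "count M d > 0" using that by simp
      with le[of d] show ?thesis by linarith
    qed
    then show "count M d = count (mset_set (set_mset M)) d"
      by (simp add: count_mset_set' not_in_iff)
  qed
  also have "set_mset M = insert h ((\<lambda>c. s c mod int n) ` lower)"
  proof (intro equalityI subsetI)
    fix d assume d: "d \<in># M"
    then have dO: "d \<in> odd_multiples" using R by blast
    note bounds = odd_multiples_bounds[OF dO]
    consider "d = h" | "d < h" | "d > h" by linarith
    then show "d \<in> insert h ((\<lambda>c. s c mod int n) ` lower)"
    proof cases
      case 2
      with d dO bounds show ?thesis
        by (intro insertI2 image_eqI[of _ _ d]) (auto simp: s_def lower_eq)
    next
      case 3
      have "count M d + count M (int n - d) = 1" using R dO 3 by blast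
      moreover have "count M d > 0" using d by simp
      ultimately have "count M (int n - d) = 0" by linarith
      then have "int n - d \<notin># M" by (simp add: not_in_iff)
      moreover have "int n - d \<in> lower"
        using 3 complement_mem[OF dO] half_eq(2) by (simp add: lower_eq)
      moreover have "- (int n - d) mod int n = d"
        using uminus_mod[of "int n - d"] bounds by simp
      ultimately show ?thesis
        by (intro insertI2 image_eqI[of _ _ "int n - d"]) (simp_all add: s_def)
    qed simp
  next
    fix d assume "d \<in> insert h ((\<lambda>c. s c mod int n) ` lower)"
    then consider "d = h" | c where "c \<in> lower" "d = s c mod int n" by blast
    then show "d \<in># M"
    proof cases
      case 1
      with R show ?thesis by (simp add: not_in_iff[symmetric] count_greater_zero_iff[symmetric])
    next
      case 2
      then have c: "c \<in> odd_multiples - {h}" by (auto simp: lower_eq)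
      then have "count M c + count M (int n - c) = 1" using R by blast
      moreover have "d = (if c \<in># M then c else int n - c)"
        using 2 c odd_multiples_bounds[of c] uminus_mod by (simp add: s_def)
      ultimately show ?thesis
        by (auto simp: not_in_iff split: if_splits simp flip: count_greater_zero_iff)
    qed
  qed
  finally have "M = mset_set (insert h ((\<lambda>c. s c mod int n) ` lower))" .
  then show "signed_set_form n lower M"
    unfolding signed_set_form_def half_eq(1) by (intro exI[of _ s]) (simp add: s_def)
qed

text \<open>\<open>M'\<close> stands for A' or B' and \<open>j\<close> for the number of junctions
  with that sign pattern. The sum on the right is the edge multiplicity in the star graph, where
  each difference in u recurs negated.\<close>

lemma signed_set_form_iff_doubled:
  assumes M': "set_mset M' \<subseteq> {0..<int n}" and M: "M = M' + replicate_mset j h"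
  shows "signed_set_form n lower M \<and> j = 1 \<longleftrightarrow>
    (\<forall>d \<in> {0..<int n}. count M' d + count M' (- d mod int n) + (if d = h then j else 0) =
       (if d \<in> odd_multiples then 1 else 0))" (is "?L \<longleftrightarrow> ?R")
proof -
  note h = odd_multiples_bounds[OF h_mem]
  have h_neg: "- h mod int n = h" using uminus_mod[of h] h half_eq(2) by simp
  have count: "count M d = count M' d + (if d = h then j else 0)" for d
    by (simp add: M)
  show ?thesis
  proof
    assume L: ?L
    then have R: "set_mset M \<subseteq> odd_multiples" "count M h = 1"
      "\<And>d. d \<in> odd_multiples \<Longrightarrow> d \<noteq> h \<Longrightarrow> count M d + count M (int n - d) = 1" and "j = 1"
      unfolding signed_set_form_iff by auto
    show ?R
    proof
      fix d assume d: "d \<in> {0..<int n}"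
      show "count M' d + count M' (- d mod int n) + (if d = h then j else 0) =
          (if d \<in> odd_multiples then 1 else 0)"
      proof (cases "d \<in> odd_multiples")
        case True
        note bounds = odd_multiples_bounds[OF True]
        show ?thesis
        proof (cases "d = h")
          case True
          with R(2) \<open>j = 1\<close> h_neg h_mem show ?thesis by (simp add: count)
        next
          case False
          with R(3)[OF True] True uminus_mod bounds half_eq(2) show ?thesis
            by (auto simp: count split: if_splits)
        qed
      next
        case False
        have "- d mod int n \<notin> odd_multiples"
        proof
          assume "- d mod int n \<in> odd_multiples"
          with complement_mem[OF this] odd_multiples_bounds[OF this] d False show False
            by (cases "d = 0") (auto simp: uminus_mod)
        qed
        with False R(1) h_mem have "d \<notin># M" "- d mod int n \<notin># M" "d \<noteq> h" by auto
        then show ?thesis using False by (simp add: M not_in_iff)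
      qed
    qed
  next
    assume R: ?R
    \<comment> \<open>Since n/2 is its own negative, \<open>M'\<close> contributes an even number
      here, and the one must come from \<open>j\<close>.\<close>
    have "count M' h + count M' h + j = 1"
      using bspec[OF R, of h] h_mem h h_neg by simp
    then have "count M' h = 0" by linarith
    with \<open>count M' h + count M' h + j = 1\<close> have j: "j = 1" "count M' h = 0" by simp_all
    have "set_mset M \<subseteq> odd_multiples"
    proof
      fix d assume "d \<in># M"
      then consider "d = h" | "d \<in># M'" by (auto simp: M split: if_splits)
      then show "d \<in> odd_multiples"
      proof cases
        case 2
        with M' have "d \<in> {0..<int n}" "count M' d > 0" by auto
        with R show ?thesis by (metis add_is_0 less_numeral_extra(3))
      qed (use h_mem in simp)
    qed
    moreover have "count M d + count M (int n - d) = 1" if d: "d \<in> odd_multiples" "d \<noteq> h" for d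
    proof -
      note bounds = odd_multiples_bounds[OF d(1)]
      then have "count M' d + count M' (int n - d) = 1"
        using bspec[OF R, of d] d uminus_mod[of d] by simp
      with d half_eq(2) show ?thesis by (simp add: count)
    qed
    moreover have "count M h = 1" using j by (simp add: count)
    ultimately show ?L using j(1) unfolding signed_set_form_iff by blast
  qed
qed

end

section \<open>Words and their translates\<close>

lemma letter_inv_letter_inv [simp]: "letter_inv (letter_inv x) = x"
  by (simp add: letter_inv_def)

lemma letter_inv_neq [simp]: "letter_inv x \<noteq> x"
  by (auto simp: letter_inv_def prod_eq_iff)

lemma word_inv_word_inv [simp]: "word_inv (word_inv v) = v"
  by (simp add: word_inv_def rev_map comp_def)

lemma length_word_inv [simp]: "length (word_inv v) = length v"
  by (simp add: word_inv_def)

lemma word_inv_append: "word_inv (v @ v') = word_inv v' @ word_inv v"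
  by (simp add: word_inv_def)

lemma word_inv_eq_Nil_iff [simp]: "word_inv v = [] \<longleftrightarrow> v = []"
  by (simp add: word_inv_def)

lemma hd_word_inv: "v \<noteq> [] \<Longrightarrow> hd (word_inv v) = letter_inv (last v)"
  by (simp add: word_inv_def hd_rev last_map)

lemma last_word_inv: "v \<noteq> [] \<Longrightarrow> last (word_inv v) = letter_inv (hd v)"
  by (simp add: word_inv_def last_rev hd_map)

lemma fst_set_word_inv: "fst ` set (word_inv v) = fst ` set v"
  by (force simp: word_inv_def letter_inv_def image_iff)

lemma reduced_word_inv: "reduced (word_inv v) \<longleftrightarrow> reduced v"
proof -
  have "letter_inv x \<noteq> y \<longleftrightarrow> y \<noteq> letter_inv x" for x y :: "'a letter"
    by blast
  then show ?thesis
    unfolding reduced_def word_inv_def successively_rev successively_map by simp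
qed

lemma reduced_append_iff:
  "reduced (v @ v') \<longleftrightarrow>
     reduced v \<and> reduced v' \<and> (v \<noteq> [] \<longrightarrow> v' \<noteq> [] \<longrightarrow> hd v' \<noteq> letter_inv (last v))"
  by (auto simp: reduced_def successively_append_iff)

lemma reduce_reduced: "reduced v \<Longrightarrow> reduce v = v"
proof (induction v)
  case Nil
  then show ?case by (simp add: reduce_def)
next
  case (Cons x v)
  then have "reduce v = v"
    by (auto simp: reduced_def successively_Cons)
  then have "reduce (x # v) = push_letter x v"
    by (simp add: reduce_def)
  also have "\<dots> = x # v"
    using Cons.prems by (cases v) (auto simp: reduced_def)
  finally show ?case .
qed

text \<open>In the middle of such a word either two adjacent letters would cancel or one letter
  would be its own inverse.\<close>

lemma word_inv_neq_self:
  assumes "reduced v" "v \<noteq> []"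
  shows "word_inv v \<noteq> v"
proof
  assume eq: "word_inv v = v"
  define k where "k = length v div 2"
  have nth: "v ! i = letter_inv (v ! (length v - Suc i))" if "i < length v" for i
  proof -
    have "v ! i = rev (map letter_inv v) ! i" using eq by (simp add: word_inv_def)
    with that show ?thesis by (simp add: rev_nth)
  qed
  show False
  proof (cases "even (length v)")
    case True
    then have "length v = 2 * k" by (simp add: k_def)
    with assms(2) have k: "length v = 2 * k" "k > 0" by (cases k; simp)+
    then have "v ! (k - 1) = letter_inv (v ! k)"
      using nth[of "k - 1"] by (simp add: algebra_simps)
    moreover have "v ! Suc (k - 1) \<noteq> letter_inv (v ! (k - 1))"
      using assms(1) k successively_nth[of "\<lambda>x y. y \<noteq> letter_inv x" v "k - 1"]
      by (simp add: reduced_def)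
    ultimately show False using k by simp
  next
    case False
    then have "length v = 2 * k + 1" by (simp add: k_def)
    then have "v ! k = letter_inv (v ! k)"
      using nth[of k] by simp
    then show False by (metis letter_inv_neq)
  qed
qed

text \<open>Powers in \<open>proper_power\<close> are reduced products; where nothing cancels they
  are plain repetitions.\<close>

lemma free_power_concat:
  assumes "reduced (concat (replicate p v))"
  shows "free_power v p = concat (replicate p v)"
  using assms
proof (induction p)
  case (Suc p)
  then have "reduced (concat (replicate p v))" by (simp add: reduced_append_iff)
  with Suc show ?case by (simp add: free_mult_def reduce_reduced)
qed simp

text \<open>A rotation fixing w splits it into two commuting factors, which are powers of a common
  word. Both factors are nonempty, so the total exponent is at least two.\<close>

lemma proper_power_of_rotate_eq:
  assumes "w \<in> free_group X" "rotate j w = w" "0 < j" "j < length w"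
  shows "proper_power X w"
proof -
  have "take j w @ drop j w = drop j w @ take j w"
    using assms(2-4) by (simp add: rotate_drop_take)
  then obtain a b v where v: "concat (replicate a v) = take j w" "concat (replicate b v) = drop j w"
    using comm_append_are_replicate by metis
  then have w: "w = concat (replicate (a + b) v)"
    by (metis append_take_drop_id concat_append replicate_add)
  have "a > 0" "b > 0"
    using v assms(3,4) by (auto intro!: gr0I)
  then obtain c where c: "a + b = Suc c" "a + b \<ge> 2"
    by (cases "a + b") auto
  have red: "reduced w" and set: "fst ` set w \<subseteq> X"
    using assms(1) by (auto simp: free_group_def)
  have "w = v @ concat (replicate c v)"
    using w c(1) by simp
  then have "v \<in> free_group X"
    using red set by (auto simp: free_group_def reduced_append_iff)
  moreover have "w = free_power v (a + b)"
    using free_power_concat w red by metis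
  ultimately show ?thesis using c(2) unfolding proper_power_def by blast
qed

text \<open>Inversion turns a rotation into the opposite rotation.\<close>

lemma rotate_word_inv_rotate: "rotate j (word_inv (rotate j v)) = word_inv v"
proof (induction j)
  case (Suc j)
  have "rotate1 (word_inv (rotate1 x)) = word_inv x" for x :: "'a word"
    by (cases x) (simp_all add: word_inv_def)
  moreover have "rotate (Suc j) x = rotate j (rotate1 x)" for x :: "'a word"
    by (simp add: rotate1_rotate_swap)
  ultimately show ?case
    using Suc by (metis rotate_Suc)
qed simp

lemma mod_add_right_cancel:
  fixes a b i n :: nat
  shows "(a + i) mod n = (b + i) mod n \<longleftrightarrow> a mod n = b mod n"
proof -
  have "int ((a + i) mod n) = int ((b + i) mod n) \<longleftrightarrow> int (a mod n) = int (b mod n)"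
    unfolding zmod_int mod_eq_dvd_iff by simp
  then show ?thesis by (simp only: of_nat_eq_iff)
qed

lemma add_mod_eq_self_imp_dvd:
  fixes a i n :: nat
  assumes "(a + i) mod n = a"
  shows "n dvd i"
proof -
  have "(i + a) mod n = (0 + a) mod n"
    using assms by (metis add.commute add_0 mod_mod_trivial)
  then show ?thesis by (simp only: mod_add_right_cancel mod_0 dvd_eq_mod_eq_0)
qed

section \<open>Shifts of subscripts\<close>

definition shift_letter :: "nat \<Rightarrow> nat \<Rightarrow> nat letter \<Rightarrow> nat letter" where
  "shift_letter n i x = ((fst x + i) mod n, snd x)"

lemma shift_letter_shift_letter [simp]:
  "shift_letter n i (shift_letter n j x) = shift_letter n (i + j) x"
  by (simp add: shift_letter_def mod_simps ac_simps)

lemma shift_letter_mod [simp]: "shift_letter n (i mod n) = shift_letter n i"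
  by (simp add: shift_letter_def mod_simps fun_eq_iff)

lemma snd_shift_letter [simp]: "snd (shift_letter n i x) = snd x"
  by (simp add: shift_letter_def)

lemma letter_inv_shift_letter [simp]:
  "letter_inv (shift_letter n i x) = shift_letter n i (letter_inv x)"
  by (simp add: shift_letter_def letter_inv_def)

lemma shift_letter_0: "fst x < n \<Longrightarrow> shift_letter n 0 x = x"
  by (simp add: shift_letter_def)

lemma shift_letter_eq_iff:
  assumes "fst x < n" "fst y < n"
  shows "shift_letter n i x = shift_letter n i y \<longleftrightarrow> x = y"
  using assms by (auto simp: shift_letter_def prod_eq_iff mod_add_right_cancel)

lemma map_shift_letter_shift_letter:
  "map (shift_letter n i) (map (shift_letter n j) v) = map (shift_letter n (i + j)) v"
  by simp

lemma map_shift_letter_0: "fst ` set v \<subseteq> {..<n} \<Longrightarrow> map (shift_letter n 0) v = v"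
  by (intro map_idI shift_letter_0) auto

lemma word_inv_map_shift_letter:
  "word_inv (map (shift_letter n i) v) = map (shift_letter n i) (word_inv v)"
  by (simp add: word_inv_def rev_map comp_def)

lemma reduced_map_shift_letter:
  assumes "fst ` set v \<subseteq> {..<n}"
  shows "reduced (map (shift_letter n i) v) \<longleftrightarrow> reduced v"
proof -
  have "fst x < n" if "x \<in> set v" for x using assms that by auto
  moreover have "fst (letter_inv x) = fst x" for x :: "nat letter" by (simp add: letter_inv_def)
  ultimately show ?thesis
    unfolding reduced_def successively_map
    by (intro successively_cong) (auto simp: shift_letter_eq_iff)
qed

lemma shift_funpow:
  assumes "fst ` set v \<subseteq> {..<n}"
  shows "(shift n ^^ i) v = map (shift_letter n i) v"
proof (induction i)
  case 0
  with assms show ?case by (simp add: map_shift_letter_0)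
next
  case (Suc i)
  have "shift n = map (shift_letter n 1)"
    by (simp add: shift_def shift_letter_def fun_eq_iff case_prod_beta)
  with Suc show ?case by simp
qed

text \<open>Isolates the half period; applied to rotations modulo the length of w and to shifts
  modulo n.\<close>

lemma mod_double_eq:
  fixes a j :: nat
  assumes "a dvd j" "\<not> 2 * a dvd j"
  shows "j mod (2 * a) = a"
proof -
  obtain k where k: "j = a * k" using assms(1) by blast
  have "odd k"
  proof
    assume "even k"
    then show False using assms(2) unfolding k by (auto simp: ac_simps)
  qed
  then obtain m where "k = 2 * m + 1" by (rule oddE)
  then have "j = a + 2 * a * m" using k by simp
  then have "j mod (2 * a) = a mod (2 * a)" by simp
  moreover have "a \<noteq> 0" using assms by auto
  ultimately show ?thesis by simp
qed

text \<open>The number m - p + q lies strictly between 0 and 2m, so it is m.\<close>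

lemma less_dvd_imp_eq:
  fixes m p q :: nat
  assumes "m dvd m - p + q" "p < m" "q < m"
  shows "q = p"
proof -
  obtain k where k: "m - p + q = m * k" using assms(1) by blast
  then have "0 < m * k" "m * k < m * 2" using assms(2,3) by linarith+
  then have "k = 1" by simp
  with k assms(2) show ?thesis by simp
qed

section \<open>The word w, its inverse and its symmetries\<close>

locale half_shift_word =
  fixes n :: nat and u w :: "nat word"
  assumes n_ge_2: "n \<ge> 2" and even_n: "even n"
    and u_in: "u \<in> free_group {..<n}" and u_nonempty: "u \<noteq> []"
    and w_eq: "w = free_mult u (word_inv ((shift n ^^ (n div 2)) u))"
    and not_power: "\<not> proper_power {..<n} w"
begin

abbreviation half :: nat where "half \<equiv> n div 2"

abbreviation translate :: "nat \<Rightarrow> nat word \<Rightarrow> nat word" where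
  "translate i \<equiv> map (shift_letter n i)"

lemma u_letters: "fst ` set u \<subseteq> {..<n}" and reduced_u: "reduced u"
  using u_in by (auto simp: free_group_def)

lemma letters_translate: "fst ` set (translate i v) \<subseteq> {..<n}"
  using n_ge_2 by (auto simp: shift_letter_def)

lemma last_u_less: "fst (last u) < n" and hd_u_less: "fst (hd u) < n"
  using subsetD[OF u_letters imageI[OF last_in_set[OF u_nonempty]]]
    subsetD[OF u_letters imageI[OF hd_in_set[OF u_nonempty]]] by simp_all

text \<open>At the junction the last letter of u meets the inverse of its translate by n/2, and 0 <
  n/2 < n; so nothing cancels there.\<close>

lemma reduced_append: "reduced (u @ word_inv (translate half u))"
proof -
  have "(fst (last u) + half) mod n \<noteq> fst (last u)"
  proof
    assume "(fst (last u) + half) mod n = fst (last u)"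
    then have "n dvd half" by (rule add_mod_eq_self_imp_dvd)
    then show False using n_ge_2 by (auto dest: dvd_imp_le)
  qed
  then have "hd (word_inv (translate half u)) \<noteq> letter_inv (last u)"
    using u_nonempty by (auto simp: hd_word_inv last_map shift_letter_def letter_inv_def)
  with reduced_u u_letters show ?thesis
    by (simp add: reduced_append_iff reduced_word_inv reduced_map_shift_letter)
qed

lemma w_append: "w = u @ word_inv (translate half u)"
  using reduced_append u_letters by (simp add: w_eq free_mult_def reduce_reduced shift_funpow)

lemma length_w: "length w = 2 * length u"
  by (simp add: w_append)

lemma w_letters: "fst ` set w \<subseteq> {..<n}"
  using u_letters letters_translate by (simp add: w_append fst_set_word_inv image_Un)

lemma w_in: "w \<in> free_group {..<n}"
  using reduced_append w_letters by (simp add: free_group_def w_append)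

lemma translate_0: "fst ` set v \<subseteq> {..<n} \<Longrightarrow> translate 0 v = v"
  by (rule map_shift_letter_0)

lemma translate_mod: "translate (i mod n) v = translate i v"
  by simp

lemma translate_n: "fst ` set v \<subseteq> {..<n} \<Longrightarrow> translate n v = v"
  using translate_mod[of n v] translate_0[of v] by simp

lemma half_half: "half + half = n"
  using even_n by auto

text \<open>Inversion exchanges the two factors of w, and translating by n/2 twice is the
  identity.\<close>

lemma word_inv_w: "word_inv w = translate half w"
proof -
  have "translate half (word_inv (translate half u)) = word_inv u"
    unfolding word_inv_map_shift_letter[symmetric] map_shift_letter_shift_letter half_half
      translate_n[OF u_letters] ..
  then show ?thesis by (simp add: w_append word_inv_append)
qed

lemma translate_translate: "translate i (translate j v) = translate (i + j) v"
  by simp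

lemma translate_eq_iff:
  assumes "fst ` set v \<subseteq> {..<n}" "fst ` set v' \<subseteq> {..<n}"
  shows "translate i v = translate i v' \<longleftrightarrow> v = v'"
proof
  assume "translate i v = translate i v'"
  moreover have "inj_on (shift_letter n i) (set v \<union> set v')"
  proof (rule inj_onI)
    fix x y assume "x \<in> set v \<union> set v'" "y \<in> set v \<union> set v'"
      "shift_letter n i x = shift_letter n i y"
    moreover from this assms have "fst x < n" "fst y < n" by blast+
    ultimately show "x = y" by (simp only: shift_letter_eq_iff)
  qed
  ultimately show "v = v'" by (metis inj_on_map_eq_map)
qed simp

lemma translate_fix:
  assumes "translate i v = v" "v \<noteq> []"
  shows "n dvd i"
proof -
  have "shift_letter n i (hd v) = hd v"
    using assms by (metis hd_map)
  then have "(fst (hd v) + i) mod n = fst (hd v)"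
    by (simp add: shift_letter_def prod_eq_iff)
  then show ?thesis by (rule add_mod_eq_self_imp_dvd)
qed

text \<open>A nontrivial rotational symmetry would exhibit w as a proper power.\<close>

lemma rotate_w_fix:
  assumes "rotate j w = w"
  shows "length w dvd j"
proof (rule ccontr)
  assume "\<not> length w dvd j"
  then have "0 < j mod length w" by (simp add: mod_greater_zero_iff_not_dvd)
  moreover have "j mod length w < length w"
    using u_nonempty by (simp add: length_w)
  ultimately show False
    using proper_power_of_rotate_eq[OF w_in] not_power assms rotate_conv_mod[of j w] by metis
qed

text \<open>
  Inverting \<open>rotate j w = translate i w\<close> yields \<open>rotate (2 * j) w = w\<close>, because inversion
  reverses rotations but acts on \<open>w\<close> as a translation.
\<close>

lemma rotate_eq_translate:
  assumes eq: "rotate j w = translate i w"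
  shows "length w dvd j \<and> n dvd i"
proof -
  have "translate half w = rotate j (word_inv (translate i w))"
    using rotate_word_inv_rotate[of j w] by (simp add: word_inv_w eq)
  also have "\<dots> = translate half (rotate j (rotate j w))"
    by (simp add: word_inv_map_shift_letter word_inv_w eq rotate_map ac_simps)
  finally have "w = rotate j (rotate j w)"
    using w_letters by (subst (asm) translate_eq_iff) auto
  then have "length w dvd j + j"
    using rotate_w_fix by (simp add: rotate_rotate)
  then have j: "length u dvd j"
    by (simp add: length_w flip: mult_2)
  have "length w dvd j"
  proof (rule ccontr)
    \<comment> \<open>Then j is an odd multiple of the length of u, so the rotation exchanges the
      two halves of w. Comparing halves shows that translation by 2i fixes u, hence n divides
      2i.\<close>
    assume nd: "\<not> length w dvd j"
    then have "j mod length w = length u"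
      using j mod_double_eq by (simp add: length_w)
    then have "rotate (length u) w = translate i w"
      using eq by (metis rotate_conv_mod)
    moreover have "rotate (length u) w = word_inv (translate half u) @ u"
      by (simp add: w_append rotate_append)
    moreover have "translate i w = translate i u @ translate i (word_inv (translate half u))"
      by (simp only: w_append map_append)
    moreover have "length (word_inv (translate half u)) = length (translate i u)" by simp
    ultimately have u: "word_inv (translate half u) = translate i u \<and>
        u = translate i (word_inv (translate half u))"
      by (metis append_eq_append_conv)
    then have "u = translate i (translate i u)" by metis
    then have "translate (i + i) u = u" by (simp only: translate_translate)
    then have "n dvd 2 * i" unfolding mult_2 using u_nonempty by (rule translate_fix)
    then have "half dvd i" using even_n by auto
    then consider "n dvd i" | "i mod n = half"
      using mod_double_eq[of half i] half_half by (auto simp: mult_2)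
    then show False
    proof cases
      case 1
      then have "translate i w = w"
        using translate_0[OF w_letters] translate_mod[of i w] by simp
      with eq rotate_w_fix nd show False by simp
    next
      \<comment> \<open>Here the translate of u by n/2 would be its own inverse.\<close>
      case 2
      then have "word_inv (translate half u) = translate half u"
        using u translate_mod[of i u] by metis
      then show False
        using word_inv_neq_self[of "translate half u"] reduced_u u_nonempty
          reduced_map_shift_letter[OF u_letters] by simp
    qed
  qed
  moreover from this have "translate i w = w"
    using eq by (metis dvd_imp_mod_0 rotate_conv_mod rotate0 id_apply)
  then have "n dvd i"
    using translate_fix u_nonempty w_append by (metis append_is_Nil_conv)
  ultimately show ?thesis ..
qed

text \<open>Undoing one rotation and one translation reduces an equality of two such words to a
  rotation of w that is a translate of w. So translation and starting position are determined by the
  word.\<close>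

lemma inj_on_rotate_translate:
  "inj_on (\<lambda>(i, p). rotate p (translate i w)) ({..<n} \<times> {..<length w})"
proof (rule inj_onI, clarsimp)
  fix i p j q
  assume less: "i < n" "p < length w" "j < n" "q < length w"
    and eq: "rotate p (translate i w) = rotate q (translate j w)"
  have "translate i w = rotate (length w - p) (rotate p (translate i w))"
    using less by (simp add: rotate_rotate)
  also have "\<dots> = translate j (rotate (length w - p + q) w)"
    unfolding eq by (simp add: rotate_rotate rotate_map)
  finally have "translate (n - j) (translate i w) = translate (n - j + j) (rotate (length w - p + q) w)"
    by (simp add: translate_translate)
  also have "\<dots> = rotate (length w - p + q) w"
    using less w_letters by (simp add: translate_n)
  finally have "rotate (length w - p + q) w = translate (n - j + i) w"
    unfolding translate_translate by (rule sym)
  then have "length w dvd length w - p + q" "n dvd n - j + i"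
    using rotate_eq_translate by blast+
  with less show "i = j \<and> p = q"
    using less_dvd_imp_eq by blast
qed

text \<open>Inverses of relators are translates by n/2 of relators, so they add nothing.\<close>

lemma symmetrised_relators_eq:
  "symmetrised_relators (cyclic_presentation n w) =
     (\<lambda>(i, p). rotate p (translate i w)) ` ({..<n} \<times> {..<length w})"
proof -
  have rels: "rels (cyclic_presentation n w) = (\<lambda>i. translate i w) ` {..<n}"
    by (simp add: cyclic_presentation_def shift_funpow[OF w_letters])
  have "word_inv ` rels (cyclic_presentation n w) \<subseteq> rels (cyclic_presentation n w)"
  proof
    fix v assume "v \<in> word_inv ` rels (cyclic_presentation n w)"
    then obtain i where "v = word_inv (translate i w)" unfolding rels by blast
    then have "v = translate ((i + half) mod n) w"
      by (simp only: word_inv_map_shift_letter word_inv_w translate_translate translate_mod)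
    moreover have "(i + half) mod n \<in> {..<n}" using n_ge_2 by simp
    ultimately show "v \<in> rels (cyclic_presentation n w)"
      unfolding rels by (rule image_eqI)
  qed
  then have "rels (cyclic_presentation n w) \<union> word_inv ` rels (cyclic_presentation n w) =
    (\<lambda>i. translate i w) ` {..<n}"
    unfolding rels by blast
  then have "symmetrised_relators (cyclic_presentation n w) =
    {rotate p (translate i w) | i p. i < n}"
    unfolding symmetrised_relators_def by auto
  also have "\<dots> = (\<lambda>(i, p). rotate p (translate i w)) ` ({..<n} \<times> {..<length w})"
  proof (intro equalityI subsetI)
    fix v assume "v \<in> {rotate p (translate i w) | i p. i < n}"
    then obtain i p where "i < n" "v = rotate p (translate i w)" by blast
    moreover from this have "v = rotate (p mod length w) (translate i w)"
      using rotate_conv_mod[of p "translate i w"] by simp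
    moreover have "p mod length w < length w" using u_nonempty by (simp add: length_w)
    ultimately show "v \<in> (\<lambda>(i, p). rotate p (translate i w)) ` ({..<n} \<times> {..<length w})"
      by (intro image_eqI[of _ _ "(i, p mod length w)"]) auto
  qed auto
  finally show ?thesis .
qed

end

section \<open>Edges of the star graph\<close>

lemma rotate_symmetrised:
  assumes "v \<in> symmetrised_relators P"
  shows "rotate i v \<in> symmetrised_relators P"
proof -
  obtain j r where "v = rotate j r" "r \<in> rels P \<union> word_inv ` rels P"
    using assms unfolding symmetrised_relators_def by blast
  moreover from this have "rotate i v = rotate (i + j) r" by (simp add: rotate_rotate)
  ultimately show ?thesis unfolding symmetrised_relators_def by blast
qed

lemma word_inv_symmetrised:
  assumes "v \<in> symmetrised_relators P"
  shows "word_inv v \<in> symmetrised_relators P"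
proof -
  obtain i r where r: "v = rotate i r" "r \<in> rels P \<union> word_inv ` rels P"
    using assms unfolding symmetrised_relators_def by blast
  define j where "j = length r - i mod length r"
  have "word_inv v = rotate j (rotate i (word_inv v))"
  proof (cases "r = []")
    case False
    then have "(j + i) mod length r = 0"
      unfolding j_def by (metis add.commute le_add_diff_inverse2 less_imp_le_nat length_greater_0_conv
          mod_add_right_eq mod_less_divisor mod_self)
    then show ?thesis
      using rotate_conv_mod[of "j + i" "word_inv v"] r(1) by (simp add: rotate_rotate)
  qed (use r in \<open>simp add: word_inv_def\<close>)
  also have "\<dots> = rotate j (word_inv r)"
    using rotate_word_inv_rotate[of i r] r(1) by simp
  finally have "word_inv v = rotate j (word_inv r)" .
  moreover have "word_inv r \<in> rels P \<union> word_inv ` rels P"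
    using r(2) by auto
  ultimately show ?thesis
    unfolding symmetrised_relators_def by blast
qed

text \<open>The symmetrised set is closed under inversion and rotation, so this form keeps the flip
  inside it.\<close>

lemma star_flip_eq_rotate:
  assumes "length v \<ge> 2"
  shows "star_flip v = rotate (length v - 2) (word_inv v)"
proof -
  obtain x y z where v: "v = x # y # z"
    using assms by (metis One_nat_def Suc_1 Suc_le_length_iff)
  then have "word_inv v = word_inv z @ [letter_inv y, letter_inv x]"
    by (simp add: word_inv_def)
  then show ?thesis
    using rotate_append[of "word_inv z" "[letter_inv y, letter_inv x]"] by (simp add: v)
qed

lemma star_flip_symmetrised:
  assumes "v \<in> symmetrised_relators P" "length v \<ge> 2"
  shows "star_flip v \<in> symmetrised_relators P"
  using star_flip_eq_rotate rotate_symmetrised word_inv_symmetrised assms by metis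

lemma star_flip_star_flip:
  assumes "length v \<ge> 2"
  shows "star_flip (star_flip v) = v"
proof -
  obtain x y z where "v = x # y # z"
    using assms by (metis One_nat_def Suc_1 Suc_le_length_iff)
  then show ?thesis by simp
qed

lemma hd_star_flip: "length v \<ge> 2 \<Longrightarrow> hd (star_flip v) = letter_inv (v ! 1)"
  by (cases v; cases "tl v") auto

lemma length_star_flip: "length v \<ge> 2 \<Longrightarrow> length (star_flip v) = length v"
  by (simp add: star_flip_eq_rotate)

lemma star_edge_ends:
  assumes "length v \<ge> 2"
  shows "hd ` {v, star_flip v} = {hd v, letter_inv (v ! 1)}"
  by (simp add: hd_star_flip[OF assms])

text \<open>
  An edge \<open>{v, star_flip v}\<close> with distinct end points \<open>x\<close> and \<open>y\<close> contains exactly one word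
  starting with \<open>x\<close>.
\<close>

lemma card_star_edges:
  assumes "x \<noteq> y"
  shows "card {e \<in> edges (star_graph P). ends (star_graph P) e = {x, y}} =
    card {v \<in> symmetrised_relators P. length v \<ge> 2 \<and> hd v = x \<and> v ! 1 = letter_inv y}"
    (is "card ?E = card ?V")
proof -
  have "bij_betw (\<lambda>v. {v, star_flip v}) ?V ?E"
  proof (rule bij_betwI')
    fix v v' assume v: "v \<in> ?V" "v' \<in> ?V"
    then have "hd (star_flip v) = y" "hd (star_flip v') = y"
      by (simp_all add: hd_star_flip)
    with v assms show "{v, star_flip v} = {v', star_flip v'} \<longleftrightarrow> v = v'"
      by (auto simp: doubleton_eq_iff)
  next
    fix v assume "v \<in> ?V"
    then show "{v, star_flip v} \<in> ?E"
      unfolding star_graph_def by (auto simp: hd_star_flip)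
  next
    fix e assume "e \<in> ?E"
    then obtain v where v: "v \<in> symmetrised_relators P" "length v \<ge> 2" "e = {v, star_flip v}"
      and ends: "hd ` {v, star_flip v} = {x, y}"
      unfolding star_graph_def by auto
    from ends have "{hd v, letter_inv (v ! 1)} = {x, y}"
      using star_edge_ends[OF v(2)] by simp
    then consider "hd v = x" "v ! 1 = letter_inv y" | "hd v = y" "letter_inv (v ! 1) = x"
      by (metis doubleton_eq_iff letter_inv_letter_inv)
    then show "\<exists>v \<in> ?V. e = {v, star_flip v}"
    proof cases
      case 1
      with v show ?thesis by blast
    next
      case 2
      have "star_flip v ! 1 = letter_inv y"
        using v(2) 2(1) by (cases v; cases "tl v") auto
      then have "star_flip v \<in> ?V"
        using v 2 by (simp add: star_flip_symmetrised length_star_flip hd_star_flip)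
      moreover have "e = {star_flip v, star_flip (star_flip v)}"
        using v by (simp add: star_flip_star_flip insert_commute)
      ultimately show ?thesis by blast
    qed
  qed
  then show ?thesis by (rule bij_betw_same_card[symmetric])
qed

section \<open>Counting edges by subscript differences\<close>

lemma zip_rotate1:
  assumes "v \<noteq> []"
  shows "zip v (rotate1 v) = zip v (tl v) @ [(last v, hd v)]"
proof -
  have "zip (x # xs) (xs @ [a]) = zip (x # xs) xs @ [(last (x # xs), a)]" for x a :: 'a and xs
    by (induction xs arbitrary: x) auto
  with assms show ?thesis by (cases v) auto
qed

lemma zip_tl_append:
  assumes "v \<noteq> []" "v' \<noteq> []"
  shows "zip (v @ v') (tl (v @ v')) = zip v (tl v) @ (last v, hd v') # zip v' (tl v')"
  using assms(1)
proof (induction v)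
  case (Cons x v)
  then show ?case
    using assms(2) by (cases v; cases v') auto
qed simp

lemma zip_tl_rev: "zip (rev v) (tl (rev v)) = rev (map prod.swap (zip v (tl v)))"
proof (induction v)
  case (Cons x v)
  then show ?case
    using zip_tl_append[of "rev v" "[x]"] by (cases v) (auto simp: last_rev)
qed simp

lemma zip_tl_map: "zip (map f v) (tl (map f v)) = map (map_prod f f) (zip v (tl v))"
  by (simp add: map_tl[symmetric] zip_map_map map_prod_def)

text \<open>A', B' and the two parts of Q differ only in the signs asked for, so \<open>s\<close>
  and \<open>t\<close> allow one argument for all patterns. The list holds the adjacent pairs of u,
  or the cyclically adjacent pairs of w.\<close>

definition differences :: "nat \<Rightarrow> bool \<Rightarrow> bool \<Rightarrow> (nat letter \<times> nat letter) list \<Rightarrow> int multiset" where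
  "differences n s t ps = mset (map (\<lambda>(x, y). (int (fst y) - int (fst x)) mod int n)
     (filter (\<lambda>(x, y). snd x = s \<and> snd y = t) ps))"

lemma differences_append: "differences n s t (ps @ qs) = differences n s t ps + differences n s t qs"
  by (simp add: differences_def)

lemma differences_Cons: "differences n s t (p # qs) = differences n s t [p] + differences n s t qs"
  by (simp add: differences_def)

lemma differences_rev: "differences n s t (rev ps) = differences n s t ps"
  by (simp add: differences_def rev_filter[symmetric] rev_map[symmetric])

lemma set_differences: "n > 0 \<Longrightarrow> set_mset (differences n s t ps) \<subseteq> {0..<int n}"
  by (auto simp: differences_def)

lemma differences_map_shift_letter:
  "differences n s t (map (map_prod (shift_letter n i) (shift_letter n i)) ps) = differences n s t ps"
proof -
  have "(int ((b + i) mod n) - int ((a + i) mod n)) mod int n = (int b - int a) mod int n" for a b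
    unfolding zmod_int of_nat_add mod_diff_eq by simp
  then show ?thesis
    by (induction ps) (auto simp: differences_def shift_letter_def)
qed

text \<open>The inverse of x y is y^-1 x^-1, so order and signs are both reversed. Patterns with
  opposite signs are thus self-inverse, while the two patterns with equal signs are
  exchanged.\<close>

lemma differences_map_letter_inv:
  "differences n s t (map (map_prod letter_inv letter_inv \<circ> prod.swap) ps) =
     image_mset (\<lambda>d. - d mod int n) (differences n (\<not> t) (\<not> s) ps)"
  by (induction ps) (auto simp: differences_def letter_inv_def mod_simps)

lemma differences_word_inv:
  "differences n s t (zip (word_inv v) (tl (word_inv v))) =
     image_mset (\<lambda>d. - d mod int n) (differences n (\<not> t) (\<not> s) (zip v (tl v)))"
proof -
  have "zip (word_inv v) (tl (word_inv v)) =
      rev (map (map_prod letter_inv letter_inv \<circ> prod.swap) (zip v (tl v)))"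
    unfolding word_inv_def zip_tl_rev zip_tl_map
    by (simp add: comp_def prod.swap_def map_prod_def case_prod_beta)
  then show ?thesis
    by (simp only: differences_rev differences_map_letter_inv)
qed

lemma A'_mset_eq: "A'_mset n v = differences n True False (zip v (tl v))"
proof -
  have "mset [(int j - int i) mod int n. ((i, True), (j, False)) \<leftarrow> ps] = differences n True False ps"
    for ps
    by (induction ps) (auto simp: differences_def split: bool.splits)
  then show ?thesis by (simp add: A'_mset_def)
qed

lemma B'_mset_eq: "B'_mset n v = differences n False True (zip v (tl v))"
proof -
  have "mset [(int j - int i) mod int n. ((i, False), (j, True)) \<leftarrow> ps] = differences n False True ps"
    for ps
    by (induction ps) (auto simp: differences_def split: bool.splits)
  then show ?thesis by (simp add: B'_mset_def)
qed

lemma Q_mset_eq: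
  "Q_mset n v = differences n True True (zip v (tl v)) +
     image_mset (\<lambda>d. - d mod int n) (differences n False False (zip v (tl v)))"
proof -
  have "mset [(int j - int i) mod int n. ((i, True), (j, True)) \<leftarrow> ps] = differences n True True ps"
    for ps
    by (induction ps) (auto simp: differences_def split: bool.splits)
  moreover have "mset [(int i - int j) mod int n. ((i, False), (j, False)) \<leftarrow> ps] =
      image_mset (\<lambda>d. - d mod int n) (differences n False False ps)"
    for ps
    by (induction ps) (auto simp: differences_def mod_simps split: bool.splits)
  ultimately show ?thesis by (simp add: Q_mset_def)
qed

lemma count_differences:
  "count (differences n s t ps) d =
     card {p. p < length ps \<and> snd (fst (ps ! p)) = s \<and> snd (snd (ps ! p)) = t \<and>
       (int (fst (snd (ps ! p))) - int (fst (fst (ps ! p)))) mod int n = d}"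
proof -
  have "count (differences n s t ps) d =
      length (filter (\<lambda>q. snd (fst q) = s \<and> snd (snd q) = t \<and>
        (int (fst (snd q)) - int (fst (fst q))) mod int n = d) ps)"
    by (induction ps) (auto simp: differences_def)
  then show ?thesis by (simp add: length_filter_conv_card)
qed

text \<open>The only candidate is the shift by c - a, which sends b to d exactly when the
  differences agree.\<close>

lemma translation_exists_iff:
  fixes a b c d n :: nat
  assumes "a < n" "b < n" "c < n" "d < n"
  shows "(\<exists>i < n. (a + i) mod n = c \<and> (b + i) mod n = d) \<longleftrightarrow>
    (int b - int a) mod int n = (int d - int c) mod int n"
proof
  assume "\<exists>i < n. (a + i) mod n = c \<and> (b + i) mod n = d"
  then obtain i where cd: "c = (a + i) mod n" "d = (b + i) mod n" by blast
  show "(int b - int a) mod int n = (int d - int c) mod int n"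
    unfolding cd zmod_int of_nat_add mod_diff_eq by simp
next
  assume eq: "(int b - int a) mod int n = (int d - int c) mod int n"
  define i where "i = (c + (n - a)) mod n"
  have "(a + i) mod n = c"
    using assms by (simp add: i_def mod_simps)
  moreover have "int ((b + i) mod n) = (int c + (int b - int a)) mod int n"
  proof -
    have "int ((b + i) mod n) = (int b + (int c + (int n - int a))) mod int n"
      using assms by (simp add: i_def mod_add_right_eq zmod_int of_nat_diff add_diff_eq)
    also have "int b + (int c + (int n - int a)) = int c + (int b - int a) + int n"
      by simp
    finally show ?thesis by simp
  qed
  then have "int ((b + i) mod n) = (int c + (int d - int c)) mod int n"
    using eq by (metis mod_add_right_eq)
  then have "(b + i) mod n = d"
    using assms by (simp add: zmod_int[symmetric])
  moreover have "i < n" using assms by (simp add: i_def)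
  ultimately show "\<exists>i < n. (a + i) mod n = c \<and> (b + i) mod n = d" by blast
qed

section \<open>Edge multiplicities as counts of subscript differences\<close>

context half_shift_word
begin

abbreviation cyclic_pairs :: "(nat letter \<times> nat letter) list" where
  "cyclic_pairs \<equiv> zip w (rotate1 w)"

lemma length_w_ge_2: "2 \<le> length w"
  using u_nonempty by (simp add: length_w Suc_le_eq)

lemma nth_w_less: "p < length w \<Longrightarrow> fst (w ! p) < n"
  using subsetD[OF w_letters imageI[OF nth_mem]] by simp

lemma hd_rotate_translate:
  assumes "p < length w"
  shows "hd (rotate p (translate i w)) = shift_letter n i (w ! p)"
proof -
  have "translate i w \<noteq> []" using assms by auto
  then show ?thesis using assms by (simp add: hd_rotate_conv_nth)
qed

lemma nth_1_rotate_translate: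
  assumes "p < length w"
  shows "rotate p (translate i w) ! 1 = shift_letter n i (w ! (Suc p mod length w))"
proof -
  have "1 < length (translate i w)" using length_w_ge_2 by simp
  moreover have "Suc p mod length w < length w" using assms by (intro mod_less_divisor) linarith
  ultimately show ?thesis by (simp add: nth_rotate)
qed

text \<open>An edge joining x and y corresponds to a word of the symmetrised set beginning x y^-1,
  hence the sign \<open>\<not> t\<close>. Such a word is a translation together with a position. The
  initial letter makes the position determine the translation, and a suitable translation exists iff
  the subscript differences agree.\<close>

lemma card_edges_eq_count:
  assumes "c < n" "d < n" "(c, s) \<noteq> (d, t)"
  shows "card {e \<in> edges (star_graph (cyclic_presentation n w)).
      ends (star_graph (cyclic_presentation n w)) e = {(c, s), (d, t)}} =
    count (differences n s (\<not> t) cyclic_pairs) ((int d - int c) mod int n)"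
proof -
  let ?D = "{..<n} \<times> {..<length w}"
  let ?F = "\<lambda>(i, p). rotate p (translate i w)"
  let ?V = "{v \<in> symmetrised_relators (cyclic_presentation n w).
    length v \<ge> 2 \<and> hd v = (c, s) \<and> v ! 1 = letter_inv (d, t)}"
  let ?next = "\<lambda>p. w ! (Suc p mod length w)"
  let ?S = "{(i, p). i < n \<and> p < length w \<and> shift_letter n i (w ! p) = (c, s) \<and>
    shift_letter n i (?next p) = (d, \<not> t)}"
  let ?T = "{p. p < length w \<and> snd (w ! p) = s \<and> snd (?next p) = (\<not> t) \<and>
    (int (fst (?next p)) - int (fst (w ! p))) mod int n = (int d - int c) mod int n}"
  have len: "length w \<ge> 2" "0 < length w"
    using length_w_ge_2 by linarith+
  note less = nth_w_less
  note first = hd_rotate_translate and second = nth_1_rotate_translate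
  have iff: "(\<exists>i < n. (fst (w ! p) + i) mod n = c \<and> (fst (?next p) + i) mod n = d) \<longleftrightarrow>
      (int (fst (?next p)) - int (fst (w ! p))) mod int n = (int d - int c) mod int n"
    if "p < length w" for p
    by (rule translation_exists_iff[OF less[OF that] less[OF mod_less_divisor[OF len(2)]] assms(1,2)])
  have image_S: "snd ` ?S = ?T"
  proof (intro equalityI subsetI)
    fix p assume "p \<in> snd ` ?S"
    then obtain i where i: "i < n" "p < length w" "shift_letter n i (w ! p) = (c, s)"
      "shift_letter n i (?next p) = (d, \<not> t)"
      by auto
    then have "(fst (w ! p) + i) mod n = c \<and> (fst (?next p) + i) mod n = d"
      "snd (w ! p) = s \<and> snd (?next p) = (\<not> t)"
      by (simp_all add: shift_letter_def prod_eq_iff)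
    with i iff[OF i(2)] show "p \<in> ?T" by blast
  next
    fix p assume p: "p \<in> ?T"
    with iff obtain i where "i < n" "(fst (w ! p) + i) mod n = c" "(fst (?next p) + i) mod n = d"
      by blast
    with p have "(i, p) \<in> ?S"
      unfolding shift_letter_def prod_eq_iff by simp
    then show "p \<in> snd ` ?S" by (rule image_eqI[rotated]) simp
  qed
  have "?V = ?F ` ?S"
  proof (intro equalityI subsetI)
    fix v assume v: "v \<in> ?V"
    then obtain i p where ip: "i < n" "p < length w" "v = rotate p (translate i w)"
      unfolding symmetrised_relators_eq by auto
    with v first second have "(i, p) \<in> ?S" by (simp add: letter_inv_def)
    with ip show "v \<in> ?F ` ?S" by (metis (no_types, lifting) case_prod_conv imageI)
  next
    fix v assume "v \<in> ?F ` ?S"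
    then obtain i p where "(i, p) \<in> ?S" "v = rotate p (translate i w)" by auto
    with len first second show "v \<in> ?V"
      unfolding symmetrised_relators_eq by (auto simp: letter_inv_def)
  qed
  moreover have "inj_on ?F ?S"
    by (rule inj_on_subset[OF inj_on_rotate_translate]) auto
  ultimately have "card ?V = card ?S" by (simp add: card_image)
  also have "\<dots> = card (snd ` ?S)"
  proof (rule card_image[symmetric], rule inj_onI, clarify)
    fix i p j q
    assume "snd (i, p) = snd (j, q)" "i < n" "j < n" "shift_letter n i (w ! p) = (c, s)"
      "shift_letter n j (w ! q) = (c, s)"
    then have "(i + fst (w ! p)) mod n = (j + fst (w ! p)) mod n"
      by (auto simp: shift_letter_def add.commute)
    with \<open>i < n\<close> \<open>j < n\<close> \<open>snd (i, p) = snd (j, q)\<close> show "i = j \<and> p = q"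
      by (simp add: mod_add_right_cancel)
  qed
  also have "\<dots> = card ?T" unfolding image_S ..
  also have "card ?T = count (differences n s (\<not> t) cyclic_pairs) ((int d - int c) mod int n)"
    unfolding count_differences
    by (intro arg_cong[of _ _ card] Collect_cong) (auto simp: nth_rotate1)
  finally show ?thesis using card_star_edges[OF assms(3)] by simp
qed

text \<open>The summands come from u, from the inverse of its translate and from the two junctions
  of the cyclic word. Translation leaves differences unchanged; at a junction a letter of u stands
  next to the inverse of its translate by n/2, which gives n/2 between opposite signs.\<close>

lemma differences_cyclic:
  "differences n s t cyclic_pairs = differences n s t (zip u (tl u)) +
     image_mset (\<lambda>d. - d mod int n) (differences n (\<not> t) (\<not> s) (zip u (tl u))) +
     (if s = t then {#} else
       (if snd (last u) = s then {#int half#} else {#}) +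
       (if snd (hd u) = t then {#int half#} else {#}))"
proof -
  let ?u' = "word_inv (translate half u)"
  have half: "half < n" "half > 0" using n_ge_2 by auto
  have "differences n s t [(last u, hd ?u')] =
      (if s \<noteq> t \<and> snd (last u) = s then {#int half#} else {#})"
  proof -
    have "(int ((fst (last u) + half) mod n) - int (fst (last u))) mod int n = int half"
      using half by (simp only: zmod_int of_nat_add mod_diff_left_eq) simp
    then show ?thesis
      using u_nonempty
      by (auto simp: differences_def hd_word_inv last_map shift_letter_def letter_inv_def)
  qed
  moreover have "differences n s t [(last ?u', hd u)] =
      (if s \<noteq> t \<and> snd (hd u) = t then {#int half#} else {#})"
  proof -
    have "(int (fst (hd u)) - int ((fst (hd u) + half) mod n)) mod int n = - int half mod int n"
      by (simp only: zmod_int of_nat_add mod_diff_right_eq) simp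
    also have "\<dots> = (int n - int half) mod int n" by simp
    also have "int n - int half = int half" using half_half by linarith
    finally have "(int (fst (hd u)) - int ((fst (hd u) + half) mod n)) mod int n = int half"
      using half by simp
    then show ?thesis
      using u_nonempty
      by (auto simp: differences_def last_word_inv hd_map shift_letter_def letter_inv_def)
  qed
  moreover have "differences n s t (zip ?u' (tl ?u')) =
     image_mset (\<lambda>d. - d mod int n) (differences n (\<not> t) (\<not> s) (zip u (tl u)))"
    by (simp only: differences_word_inv zip_tl_map differences_map_shift_letter)
  moreover have "cyclic_pairs = zip u (tl u) @ (last u, hd ?u') # zip ?u' (tl ?u') @ [(last ?u', hd u)]"
    using u_nonempty zip_rotate1[of w] zip_tl_append[of u ?u'] by (simp add: w_append)
  moreover have "differences n s t (zip u (tl u) @ (last u, hd ?u') # zip ?u' (tl ?u') @ [(last ?u', hd u)]) =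
      differences n s t (zip u (tl u)) + (differences n s t [(last u, hd ?u')] +
      (differences n s t (zip ?u' (tl ?u')) + differences n s t [(last ?u', hd u)]))"
    by (subst differences_append, subst differences_Cons, subst differences_append) (rule refl)
  ultimately show ?thesis
    by (auto simp: ac_simps)
qed

lemma Q_mset_cyclic: "differences n True True cyclic_pairs = Q_mset n u"
  by (simp add: differences_cyclic Q_mset_eq)

text \<open>The junction after u has the sign pattern of A if the last letter of u is positive, the
  one closing the cycle if the first letter is negative. The sum replaces the case distinction in
  \<open>A_mset\<close>.\<close>

definition junctions_A :: nat where
  "junctions_A = of_bool (snd (last u)) + of_bool (\<not> snd (hd u))"

definition junctions_B :: nat where
  "junctions_B = of_bool (\<not> snd (last u)) + of_bool (snd (hd u))"

lemma A_mset_eq: "A_mset n u = A'_mset n u + replicate_mset junctions_A (int half)"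
  by (auto simp: A_mset_def junctions_A_def zdiv_int numeral_2_eq_2)

lemma B_mset_eq: "B_mset n u = B'_mset n u + replicate_mset junctions_B (int half)"
  by (auto simp: B_mset_def junctions_B_def zdiv_int numeral_2_eq_2)

lemma count_image_uminus_mod:
  assumes "set_mset M \<subseteq> {0..<int n}" "d \<in> {0..<int n}"
  shows "count (image_mset (\<lambda>d. - d mod int n) M) d = count M (- d mod int n)"
  using assms(1)
proof (induction M)
  case (add x M)
  have "- x mod int n = d \<longleftrightarrow> x = - d mod int n"
    using add.prems assms(2) by (auto simp: mod_minus_eq)
  with add show ?case by auto
qed simp

lemma set_A'_mset: "set_mset (A'_mset n u) \<subseteq> {0..<int n}"
  and set_B'_mset: "set_mset (B'_mset n u) \<subseteq> {0..<int n}"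
  using n_ge_2 set_differences by (simp_all add: A'_mset_eq B'_mset_eq)

lemma count_cyclic_A:
  assumes "d \<in> {0..<int n}"
  shows "count (differences n True False cyclic_pairs) d =
    count (A'_mset n u) d + count (A'_mset n u) (- d mod int n) + (if d = int half then junctions_A else 0)"
  using count_image_uminus_mod[OF set_A'_mset assms]
  by (auto simp: differences_cyclic A'_mset_eq junctions_A_def)

lemma count_cyclic_B:
  assumes "d \<in> {0..<int n}"
  shows "count (differences n False True cyclic_pairs) d =
    count (B'_mset n u) d + count (B'_mset n u) (- d mod int n) + (if d = int half then junctions_B else 0)"
  using count_image_uminus_mod[OF set_B'_mset assms]
  by (auto simp: differences_cyclic B'_mset_eq junctions_B_def)

text \<open>Both patterns start with a positive letter, so this counts the positive letters of w;
  those in its second half correspond to the negative letters of u.\<close>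

lemma size_cyclic:
  "size (differences n True False cyclic_pairs) + size (differences n True True cyclic_pairs) = length u"
proof -
  have "size (differences n True False ps) + size (differences n True True ps) =
      length (filter snd (map fst ps))" for ps
  proof -
    have "size (differences n s t ps) = length (filter (\<lambda>p. snd (fst p) = s \<and> snd (snd p) = t) ps)"
      for s t
      by (simp only: differences_def size_mset length_map case_prod_beta')
    moreover have "length (filter (\<lambda>p. snd (fst p) = True \<and> snd (snd p) = False) ps) +
        length (filter (\<lambda>p. snd (fst p) = True \<and> snd (snd p) = True) ps) =
        length (filter snd (map fst ps))"
      by (induction ps) auto
    ultimately show ?thesis by simp
  qed
  moreover have "map fst cyclic_pairs = w" by simp
  ultimately have "size (differences n True False cyclic_pairs) +
      size (differences n True True cyclic_pairs) = length (filter snd w)"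
    by metis
  moreover have "length (filter snd (word_inv (translate half u))) = length (filter (\<lambda>x. \<not> snd x) u)"
    by (simp add: word_inv_def rev_filter[symmetric] filter_map comp_def letter_inv_def)
  ultimately show ?thesis
    using sum_length_filter_compl[of snd u] by (simp add: w_append)
qed

text \<open>Cyclic reducedness of w: at the wrap-around the shift by n/2 prevents
  cancellation.\<close>

lemma next_letter_neq:
  assumes "p < length w"
  shows "w ! (Suc p mod length w) \<noteq> letter_inv (w ! p)"
proof (cases "Suc p < length w")
  case True
  have "reduced w" using w_in by (simp add: free_group_def)
  then show ?thesis
    using True successively_nth[of "\<lambda>x y. y \<noteq> letter_inv x" w p] by (simp add: reduced_def)
next
  case False
  with assms have p: "p = length w - 1" by simp
  have "hd w = hd u" "last w = letter_inv (shift_letter n half (hd u))"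
    using u_nonempty by (simp_all add: w_append last_word_inv hd_map)
  moreover have "shift_letter n half (hd u) \<noteq> hd u"
  proof
    assume "shift_letter n half (hd u) = hd u"
    then have "(fst (hd u) + half) mod n = fst (hd u)"
      by (simp add: shift_letter_def prod_eq_iff)
    then have "n dvd half" by (rule add_mod_eq_self_imp_dvd)
    then show False using n_ge_2 by (auto dest: dvd_imp_le)
  qed
  moreover have "w \<noteq> []" using u_nonempty by (simp add: w_append)
  ultimately show ?thesis
    using p by (metis False Suc_diff_1 assms hd_conv_nth last_conv_nth length_greater_0_conv
        letter_inv_letter_inv mod_self)
qed

text \<open>A zero difference between opposite signs would be a cancelling pair. This settles the
  case of equal end points, which the edge count excludes.\<close>

lemma zero_notin_differences: "0 \<notin># differences n s (\<not> s) cyclic_pairs"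
proof
  assume "0 \<in># differences n s (\<not> s) cyclic_pairs"
  then have "count (differences n s (\<not> s) cyclic_pairs) 0 > 0" by simp
  then obtain p where p: "p < length w" "snd (w ! p) = s" "snd (w ! (Suc p mod length w)) = (\<not> s)"
    "(int (fst (w ! (Suc p mod length w))) - int (fst (w ! p))) mod int n = 0"
    unfolding count_differences by (auto simp: card_gt_0_iff nth_rotate1 mod_eq_0_iff_dvd)
  note less = nth_w_less
  have "Suc p mod length w < length w" using p(1) by (intro mod_less_divisor) linarith
  then have "fst (w ! (Suc p mod length w)) = fst (w ! p)"
    using p(1,4) less mod_eq_dvd_iff[of "int (fst (w ! (Suc p mod length w)))" "int n" "int (fst (w ! p))"]
    by (simp add: mod_eq_0_iff_dvd)
  with p have "w ! (Suc p mod length w) = letter_inv (w ! p)"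
    by (simp add: letter_inv_def prod_eq_iff)
  with next_letter_neq p(1) show False by blast
qed

section \<open>The star graph as a loop-free graph\<close>

abbreviation G :: "(nat letter, nat word set) multigraph" where
  "G \<equiv> star_graph (cyclic_presentation n w)"

lemma verts_G: "verts G = {..<n} \<times> UNIV"
  by (simp add: star_graph_def cyclic_presentation_def)

lemma finite_edges_G: "finite (edges G)"
proof -
  have "edges G \<subseteq> (\<lambda>v. {v, star_flip v}) ` symmetrised_relators (cyclic_presentation n w)"
    unfolding star_graph_def by auto
  then show ?thesis
    by (rule finite_subset) (simp add: symmetrised_relators_eq)
qed

sublocale loopfree G
proof
  fix e assume "e \<in> edges G"
  then obtain v where v: "v \<in> symmetrised_relators (cyclic_presentation n w)" "length v \<ge> 2"
    "e = {v, star_flip v}"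
    unfolding star_graph_def by auto
  then obtain i p where p: "p < length w" "v = rotate p (translate i w)"
    unfolding symmetrised_relators_eq by auto
  have hd: "hd v = shift_letter n i (w ! p)" "v ! 1 = shift_letter n i (w ! (Suc p mod length w))"
    unfolding p(2) by (rule hd_rotate_translate[OF p(1)], rule nth_1_rotate_translate[OF p(1)])
  note less = nth_w_less
  have "Suc p mod length w < length w" using p(1) by (intro mod_less_divisor) linarith
  then have "fst (w ! p) < n" "fst (letter_inv (w ! (Suc p mod length w))) < n"
    using less p(1) by (simp_all add: letter_inv_def)
  moreover note hd
  \<comment> \<open>Equal end points would mean a cancelling pair in the cyclic word w.\<close>
  moreover have "w ! p \<noteq> letter_inv (w ! (Suc p mod length w))"
    using next_letter_neq[OF p(1)] by (metis letter_inv_letter_inv)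
  ultimately have "hd v \<noteq> letter_inv (v ! 1)" "fst (hd v) < n" "fst (letter_inv (v ! 1)) < n"
    by (auto simp: shift_letter_eq_iff) (simp_all add: shift_letter_def)
  moreover have "ends G e = {hd v, letter_inv (v ! 1)}"
    using star_edge_ends[OF v(2)] v(3) by (simp add: star_graph_def)
  ultimately show "\<exists>x \<in> verts G. \<exists>y \<in> verts G. x \<noteq> y \<and> ends G e = {x, y}"
    unfolding verts_G by (metis UNIV_I lessThan_iff mem_Times_iff)
qed

lemma adjacent_G_iff:
  assumes "c < n" "d < n"
  shows "adjacent G (c, s) (d, t) \<longleftrightarrow> (int d - int c) mod int n \<in># differences n s (\<not> t) cyclic_pairs"
proof (cases "(c, s) = (d, t)")
  case True
  have "\<not> adjacent G (d, t) (d, t)"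
    using adjacent_verts(3) by blast
  with True show ?thesis
    using zero_notin_differences by simp
next
  case False
  have "adjacent G (c, s) (d, t) \<longleftrightarrow> {e \<in> edges G. ends G e = {(c, s), (d, t)}} \<noteq> {}"
    unfolding adjacent_def by blast
  also have "\<dots> \<longleftrightarrow> card {e \<in> edges G. ends G e = {(c, s), (d, t)}} > 0"
    using finite_edges_G by (simp add: card_gt_0_iff)
  finally show ?thesis
    using card_edges_eq_count[OF assms False] by simp
qed

text \<open>Every residue d is the difference of the subscripts 0 and d, so bounding all counts by
  one amounts to excluding parallel edges.\<close>

lemma inj_on_ends_iff:
  "inj_on (ends G) (edges G) \<longleftrightarrow>
     (\<forall>s t. \<forall>d \<in> {0..<int n}. count (differences n s t cyclic_pairs) d \<le> 1)"
proof (intro iffI allI ballI)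
  fix s t d
  assume inj: "inj_on (ends G) (edges G)" and d: "d \<in> {0..<int n}"
  show "count (differences n s t cyclic_pairs) d \<le> 1"
  proof (cases "(0, s) = (nat d, \<not> t)")
    case True
    with d have "d = 0" "t = (\<not> s)" by auto
    then show ?thesis using zero_notin_differences[of s] by (simp add: not_in_iff)
  next
    case False
    have "card {e \<in> edges G. ends G e = {(0, s), (nat d, \<not> t)}} \<le> 1"
      unfolding One_nat_def
      using inj finite_edges_G by (subst card_le_Suc0_iff_eq) (auto dest: inj_onD)
    with card_edges_eq_count[OF _ _ False] d n_ge_2 show ?thesis by auto
  qed
next
  assume le: "\<forall>s t. \<forall>d \<in> {0..<int n}. count (differences n s t cyclic_pairs) d \<le> 1"
  show "inj_on (ends G) (edges G)"
  proof (rule inj_onI)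
    fix e e' assume e: "e \<in> edges G" "e' \<in> edges G" "ends G e = ends G e'"
    obtain c s d t where cd: "c < n" "d < n" "(c, s) \<noteq> (d, t)" "ends G e = {(c, s), (d, t)}"
      using ends_wf[OF e(1)] unfolding verts_G by auto
    then have "card {e \<in> edges G. ends G e = {(c, s), (d, t)}} \<le> 1"
      using card_edges_eq_count[OF cd(1-3)] le n_ge_2 by simp
    then show "e = e'"
      using e cd(4) finite_edges_G by (auto simp: card_le_Suc0_iff_eq)
  qed
qed

end

section \<open>The star graph and residues\<close>

lemma dvd_mod_diff: "(m::int) dvd n \<Longrightarrow> m dvd a mod n - a"
  by (meson dvd_trans mod_eq_dvd_iff mod_mod_trivial)

context half_shift_word
begin

text \<open>The differences as a periodic relation on the integers. \<open>s\<close> and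
  \<open>t\<close> are the signs of the two vertices; the second letter of the word is the inverse
  of the second vertex, hence \<open>\<not> t\<close>.\<close>

abbreviation R :: "bool \<Rightarrow> bool \<Rightarrow> int \<Rightarrow> bool" where
  "R s t a \<equiv> a mod int n \<in># differences n s (\<not> t) cyclic_pairs"

lemma n_pos: "n > 0"
  using n_ge_2 by simp

lemma half_bounds: "int half \<in> {0..<int n}"
  using n_ge_2 by auto

text \<open>Realises integer differences at vertices with reduced subscripts, so that facts about
  paths become facts about sums of differences.\<close>

lemma adjacent_residue:
  "adjacent G (nat (a mod int n), s) (nat (b mod int n), t) \<longleftrightarrow> R s t (b - a)"
  using n_pos by (subst adjacent_G_iff) (simp_all add: nat_less_iff mod_diff_eq)

lemma R_sym: "R s t a \<Longrightarrow> R t s (- a)"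
  using adjacent_residue[of 0 s a t] adjacent_residue[of a t 0 s] adjacent_sym by force

lemma R_sym_iff: "R s t a \<longleftrightarrow> R t s (- a)"
  using R_sym[where s = s and t = t and a = a] R_sym[where s = t and t = s and a = "- a"] by auto

text \<open>Each junction contributes n/2 to one of the two levels; the signs at the ends of u
  decide which.\<close>

lemma R_half: "\<exists>s. R s s (int half)"
proof -
  have "junctions_A > 0 \<or> junctions_B > 0"
    by (simp add: junctions_A_def junctions_B_def)
  then have "count (differences n True False cyclic_pairs) (int half) > 0 \<or>
      count (differences n False True cyclic_pairs) (int half) > 0"
    using count_cyclic_A[OF half_bounds] count_cyclic_B[OF half_bounds] by auto
  then have "R True True (int half) \<or> R False False (int half)"
    using half_bounds by simp
  then show ?thesis by blast
qed

text \<open>A non-alternating word has two adjacent letters of equal sign, and these contribute to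
  Q.\<close>

lemma R_cross:
  assumes "\<not> alternating u" "length u \<ge> 2"
  shows "\<exists>q. R True False q"
proof -
  obtain i where i: "Suc i < length u" "snd (u ! i) = snd (u ! Suc i)"
    using assms by (auto simp: alternating_def successively_conv_nth)
  have "zip u (tl u) ! i = (u ! i, u ! Suc i)"
    using i(1) by (simp add: nth_tl)
  moreover have "i < length (zip u (tl u))" using i(1) by simp
  ultimately have "(u ! i, u ! Suc i) \<in> set (zip u (tl u))"
    using nth_mem by metis
  then have "differences n (snd (u ! i)) (snd (u ! i)) (zip u (tl u)) \<noteq> {#}"
    using i(2) by (cases "u ! i"; cases "u ! Suc i") (auto simp: differences_def filter_empty_conv)
  then have "Q_mset n u \<noteq> {#}"
    unfolding Q_mset_eq by (cases "snd (u ! i)") auto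
  then obtain q where "q \<in># differences n True True cyclic_pairs"
    unfolding Q_mset_cyclic by blast
  moreover from this have "q \<in> {0..<int n}"
    using set_differences[OF n_pos] by blast
  ultimately show ?thesis by (intro exI[of _ q]) simp
qed

text \<open>The offset m - q on inverse generators makes a cross step of q change the label by m,
  just as a level step does.\<close>

definition vertex_residue :: "int \<Rightarrow> int \<Rightarrow> nat letter \<Rightarrow> int" where
  "vertex_residue m q x = (if snd x then int (fst x) else int (fst x) - q + m)"

lemma residue_bipartite_star_graph:
  assumes "m > 0" "2 * int m dvd int n"
    and level: "\<And>s a. R s s a \<longleftrightarrow> 2 * int m dvd a - int m"
    and cross: "\<And>a. R True False a \<longleftrightarrow> 2 * int m dvd a - q"
  shows "residue_bipartite G (vertex_residue (int m) q) m"
proof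
  show "m > 0" by fact
next
  fix x y assume "x \<in> verts G" "y \<in> verts G"
  then obtain c s d t where xy: "x = (c, s)" "y = (d, t)" "c < n" "d < n"
    unfolding verts_G by auto
  have "adjacent G x y \<longleftrightarrow> R s t (int d - int c)"
    unfolding xy by (rule adjacent_G_iff[OF xy(3,4)])
  also have "\<dots> \<longleftrightarrow> 2 * int m dvd vertex_residue (int m) q y - vertex_residue (int m) q x - int m"
  proof (cases "s = t")
    case True
    then show ?thesis
      using level[where s = s and a = "int d - int c"] xy by (simp add: vertex_residue_def)
  next
    case False
    show ?thesis
    proof (cases s)
      case True
      with False cross[where a = "int d - int c"] xy show ?thesis
        by (simp add: vertex_residue_def algebra_simps)
    next
      case False
      with \<open>s \<noteq> t\<close> have st: "s = False" "t = True" by auto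
      have "R s t (int d - int c) \<longleftrightarrow> 2 * int m dvd - (int d - int c) - q"
        unfolding st using R_sym_iff[where s = False and t = True] cross by blast
      \<comment> \<open>Modulo 2m the label differences m and -m agree, so the reversed cross step
        fits as well.\<close>
      also have "\<dots> \<longleftrightarrow> 2 * int m dvd - (- (int d - int c) - q) - 2 * int m"
        by (metis dvd_diff_left_iff dvd_minus_iff dvd_refl)
      finally show ?thesis
        using xy by (simp add: st vertex_residue_def algebra_simps)
    qed
  qed
  finally show "adjacent G x y \<longleftrightarrow>
    2 * int m dvd vertex_residue (int m) q y - vertex_residue (int m) q x - int m" .
next
  fix r
  have "2 * int m dvd vertex_residue (int m) q (nat (r mod int n), True) - r"
    using dvd_mod_diff[OF assms(2)] n_pos by (simp add: vertex_residue_def)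
  moreover have "(nat (r mod int n), True) \<in> verts G"
    unfolding verts_G using n_pos by (simp add: nat_less_iff)
  ultimately show "\<exists>x \<in> verts G. 2 * int m dvd vertex_residue (int m) q x - r" by blast
qed

text \<open>With n = 2ml every label is carried by l positive vertices, so l \<ge> 3 supplies three
  of them. Shifts of subscripts move all labels equally.\<close>

lemma simple_residue_bipartite_star_graph:
  assumes "residue_bipartite G (vertex_residue (int m) q) m" and inj: "inj_on (ends G) (edges G)"
    and n: "int n = 2 * int m * l" "l \<ge> 3"
  shows "simple_residue_bipartite G (vertex_residue (int m) q) m"
proof -
  interpret residue_bipartite G "vertex_residue (int m) q" m by fact
  show ?thesis
  proof
    show "inj_on (ends G) (edges G)" "finite (edges G)"
      by (rule inj, rule finite_edges_G)
  next
    fix r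
    define x where "x j = (nat ((r + 2 * j * int m) mod int n), True)" for j
    have bij: "bij_betw (\<lambda>j. (r + 2 * j * int m) mod int n) {0..<l}
        {d \<in> {0..<int n}. 2 * int m dvd d - r}"
      using residue_class_bij m_pos n by simp
    have mem: "(r + 2 * j * int m) mod int n \<in> {d \<in> {0..<int n}. 2 * int m dvd d - r}"
      if "j \<in> {0..<l}" for j
      using bij that by (rule bij_betw_apply)
    have x: "x j \<in> verts G \<and> 2 * int m dvd vertex_residue (int m) q (x j) - r" if "j \<in> {0..<l}" for j
      using mem[OF that] by (auto simp: x_def verts_G vertex_residue_def nat_less_iff)
    have inj_x: "x i \<noteq> x j" if "i \<in> {0..<l}" "j \<in> {0..<l}" "i \<noteq> j" for i j
    proof -
      have "(r + 2 * i * int m) mod int n \<noteq> (r + 2 * j * int m) mod int n"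
        using inj_on_eq_iff[OF bij_betw_imp_inj_on[OF bij] that(1,2)] that(3) by simp
      then show ?thesis
        using mem[OF that(1)] mem[OF that(2)] by (simp add: x_def eq_nat_nat_iff)
    qed
    have "0 \<in> {0..<l}" "1 \<in> {0..<l}" "2 \<in> {0..<l}" using n(2) by simp_all
    then show "\<exists>x \<in> verts G. \<exists>y \<in> verts G. \<exists>z \<in> verts G. distinct [x, y, z] \<and>
        2 * int m dvd vertex_residue (int m) q x - r \<and>
        2 * int m dvd vertex_residue (int m) q y - r \<and>
        2 * int m dvd vertex_residue (int m) q z - r"
      using x[of 0] x[of 1] x[of 2] inj_x[of 0 1] inj_x[of 0 2] inj_x[of 1 2]
      by (intro bexI[of _ "x 0"] bexI[of _ "x 1"] bexI[of _ "x 2"]) auto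
  next
    fix t
    define i where "i = nat (t mod int n)"
    have "inj_on (shift_letter n i) (verts G)"
      by (intro inj_onI) (metis (no_types, lifting) shift_letter_eq_iff SigmaE fst_conv lessThan_iff verts_G)
    moreover have "shift_letter n i ` verts G \<subseteq> verts G"
      unfolding verts_G using n_pos by (auto simp: shift_letter_def)
    moreover have "finite (verts G)" by (simp add: verts_G)
    ultimately have "bij_betw (shift_letter n i) (verts G) (verts G)"
      unfolding bij_betw_def using endo_inj_surj by blast
    moreover have "2 * int m dvd vertex_residue (int m) q (shift_letter n i x) - vertex_residue (int m) q x - t"
      for x
    proof -
      have i: "int i = t mod int n" using n_pos by (simp add: i_def)
      have "2 * int m dvd (int (fst x) + int i) mod int n - (int (fst x) + int i)"
        "2 * int m dvd t mod int n - t"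
        using dvd_mod_diff n by (metis dvd_triv_left)+
      then have "2 * int m dvd ((int (fst x) + int i) mod int n - (int (fst x) + int i)) + (t mod int n - t)"
        by (rule dvd_add)
      then show ?thesis
        unfolding i by (simp add: vertex_residue_def shift_letter_def zmod_int i algebra_simps)
    qed
    ultimately show "\<exists>T. bij_betw T (verts G) (verts G) \<and>
        (\<forall>x \<in> verts G. 2 * int m dvd vertex_residue (int m) q (T x) - vertex_residue (int m) q x - t)"
      by blast
  qed
qed

lemma cyclically_reduced_translate: "cyclically_reduced (translate i w)"
proof -
  have red: "reduced (translate i w)"
    using w_in w_letters by (simp add: reduced_map_shift_letter free_group_def)
  have w: "w \<noteq> []" using length_w_ge_2 by auto
  then have "w ! 0 \<noteq> letter_inv (w ! (length w - 1))"
    using next_letter_neq[of "length w - 1"] by simp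
  moreover have "fst (w ! 0) < n" "fst (letter_inv (w ! (length w - 1))) < n"
    using nth_w_less[of 0] nth_w_less[of "length w - 1"] w by (simp_all add: letter_inv_def)
  ultimately have "shift_letter n i (hd w) \<noteq> shift_letter n i (letter_inv (last w))"
    using w by (simp add: shift_letter_eq_iff hd_conv_nth last_conv_nth)
  with red w show ?thesis
    by (simp add: cyclically_reduced_def hd_map last_map)
qed

lemma special_of_simple_residue_bipartite:
  assumes "simple_residue_bipartite G f m" "length u \<ge> 2"
  shows "special 2 (length w) m (cyclic_presentation n w)"
proof -
  interpret S: simple_residue_bipartite G f m by fact
  have rels: "rels (cyclic_presentation n w) = (\<lambda>i. translate i w) ` {..<n}"
    by (simp add: cyclic_presentation_def shift_funpow[OF w_letters])
  have gens: "gens (cyclic_presentation n w) = {..<n}"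
    by (simp add: cyclic_presentation_def)
  have comp: "\<exists>r. C = S.component r" if "C \<in> components G" for C
    using that S.components_eq by blast
  have "length w \<ge> 4" using assms(2) by (simp add: length_w)
  moreover have "\<forall>r \<in> rels (cyclic_presentation n w). fst ` set r \<subseteq> {..<n} \<and> cyclically_reduced r"
    unfolding rels using letters_translate cyclically_reduced_translate by blast
  moreover have "\<forall>C \<in> components G. connected_graph C \<and> bipartite C \<and> diameter C = enat 2 \<and>
      girth C = enat (2 * 2) \<and> (\<forall>x \<in> verts C. degree C x \<ge> 3)"
    using comp S.connected_component S.bipartite_component S.diameter_component S.girth_component
      S.degree_component by metis
  moreover have "\<forall>C \<in> components G. \<forall>D \<in> components G. isomorphic_graphs C D"
    using comp S.isomorphic_components by metis
  moreover have "\<forall>r \<in> rels (cyclic_presentation n w). length r = length w"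
    unfolding rels by auto
  moreover have "finite (rels (cyclic_presentation n w))" unfolding rels by simp
  ultimately show ?thesis
    unfolding special_def using S.card_components S.m_pos by (simp add: gens)
qed

end

section \<open>The characterisation\<close>

context half_shift_word
begin

lemma count_eq_of_R:
  assumes "inj_on (ends G) (edges G)" "d \<in> {0..<int n}"
  shows "count (differences n s (\<not> t) cyclic_pairs) d = (if R s t d then 1 else 0)"
proof -
  have "count (differences n s (\<not> t) cyclic_pairs) d \<le> 1"
    using inj_on_ends_iff assms by blast
  moreover have "d mod int n = d" using assms(2) by simp
  moreover have "d \<in># differences n s (\<not> t) cyclic_pairs \<longleftrightarrow> count (differences n s (\<not> t) cyclic_pairs) d > 0"
    by simp
  ultimately show ?thesis by (simp only: split: if_splits) linarith
qed

lemma mset_eq_residue_class: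
  assumes "set_mset M \<subseteq> {0..<int n}"
    and "\<And>d. d \<in> {0..<int n} \<Longrightarrow> count M d = (if 2 * m dvd d - r then 1 else 0)"
  shows "M = mset_set {d \<in> {0..<int n}. 2 * m dvd d - r}"
proof (rule multiset_eqI)
  fix d
  have "finite {d \<in> {0..<int n}. 2 * m dvd d - r}"
    by (rule finite_subset[of _ "{0..<int n}"]) auto
  moreover have "count M d = 0" if "d \<notin> {0..<int n}"
    using that assms(1) by (auto simp: count_eq_zero_iff)
  ultimately show "count M d = count (mset_set {d \<in> {0..<int n}. 2 * m dvd d - r}) d"
    using assms(2)[of d] by (cases "d \<in> {0..<int n}") (auto simp: count_mset_set')
qed

text \<open>Here n/m - 2 = 2l - 2, so the index set is {0..<l}.\<close>

lemma image_mset_residue_class: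
  assumes "m > 0" "int n = 2 * m * l" "l > 0"
  shows "image_mset (\<lambda>j. (r + 2 * j * m) mod int n) (mset_set {j. 0 \<le> j \<and> 2 * j \<le> int n div m - 2}) =
    mset_set {d \<in> {0..<int n}. 2 * m dvd d - r}"
proof -
  have "int n div m = 2 * l" using assms(1,2) by simp
  then have "{j. 0 \<le> j \<and> 2 * j \<le> int n div m - 2} = {0..<l}" by auto
  then show ?thesis
    using residue_class_bij[OF assms, of r] by (simp add: bij_betw_def image_mset_mset_set)
qed

text \<open>A common divisor of q and m divides every element of m + 2m\<int> and q + 2m\<int>,
  hence all differences of consecutive subscripts in w, hence all differences of its subscripts; it
  also divides n.\<close>

lemma coprime_of_irreducible:
  assumes irr: "irreducible_presentation n w"
    and n: "int m dvd int n"
    and level: "\<And>s a. R s s a \<longleftrightarrow> 2 * int m dvd a - int m"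
    and cross: "\<And>a. R True False a \<longleftrightarrow> 2 * int m dvd a - q"
  shows "coprime q (int m)"
proof -
  define g where "g = gcd q (int m)"
  have g: "g dvd q" "g dvd int m" by (simp_all add: g_def)
  then have g2: "g dvd 2 * int m" by simp
  have R_dvd: "g dvd a" if "R s t a" for s t a
  proof -
    have TF: "g dvd a" if "R True False a" for a
      using dvd_trans[OF g2 iffD1[OF cross that]] g(1) by (metis dvd_diff_right_iff dvd_diff_commute)
    consider "s = t" | "s = True" "t = False" | "s = False" "t = True" by auto
    then show ?thesis
    proof cases
      case 1
      with that level have "2 * int m dvd a - int m" by blast
      then have "g dvd a - int m" using g2 by (rule dvd_trans[rotated])
      then have "g dvd (a - int m) + int m" using g(2) by (rule dvd_add)
      then show ?thesis by simp
    next
      case 2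
      with that TF show ?thesis by blast
    next
      case 3
      with that R_sym have "R True False (- a)" by blast
      with TF have "g dvd - a" by blast
      then show ?thesis by simp
    qed
  qed
  have step: "g dvd int (fst (w ! Suc p)) - int (fst (w ! p))" if "Suc p < length w" for p
  proof (rule R_dvd)
    have "differences n (snd (w ! p)) (snd (w ! Suc p)) [(w ! p, w ! Suc p)] =
        {#(int (fst (w ! Suc p)) - int (fst (w ! p))) mod int n#}"
      by (simp add: differences_def case_prod_beta)
    moreover have "(w ! p, w ! Suc p) \<in> set cyclic_pairs"
    proof -
      have "cyclic_pairs ! p = (w ! p, w ! Suc p)" "p < length cyclic_pairs"
        using that by (simp_all add: nth_rotate1)
      then show ?thesis by (metis nth_mem)
    qed
    then obtain xs ys where "cyclic_pairs = xs @ (w ! p, w ! Suc p) # ys"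
      by (meson split_list)
    then have "differences n (snd (w ! p)) (snd (w ! Suc p)) cyclic_pairs =
        differences n (snd (w ! p)) (snd (w ! Suc p)) xs +
        (differences n (snd (w ! p)) (snd (w ! Suc p)) [(w ! p, w ! Suc p)] +
        differences n (snd (w ! p)) (snd (w ! Suc p)) ys)"
      by (simp only: differences_append differences_Cons[of _ _ _ _ ys])
    ultimately show "R (snd (w ! p)) (\<not> snd (w ! Suc p)) (int (fst (w ! Suc p)) - int (fst (w ! p)))"
      by simp
  qed
  have from_0: "g dvd int (fst (w ! p)) - int (fst (w ! 0))" if "p < length w" for p
    using that
  proof (induction p)
    case (Suc p)
    then have "g dvd (int (fst (w ! Suc p)) - int (fst (w ! p))) + (int (fst (w ! p)) - int (fst (w ! 0)))"
      by (intro dvd_add step) simp_all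
    then show ?case by simp
  qed simp
  have "g dvd int i - int j" if ij: "i \<in> fst ` set w" "j \<in> fst ` set w" for i j
  proof -
    obtain p p' where p: "p < length w" "i = fst (w ! p)" "p' < length w" "j = fst (w ! p')"
      using ij by (auto simp: in_set_conv_nth)
    have "g dvd (int i - int (fst (w ! 0))) - (int j - int (fst (w ! 0)))"
      unfolding p(2,4) by (intro dvd_diff from_0 p(1,3))
    then show ?thesis by simp
  qed
  moreover have "g dvd int n" using g(2) n by (rule dvd_trans)
  ultimately have "g dvd Gcd (insert (int n) {int i - int j | i j. i \<in> fst ` set w \<and> j \<in> fst ` set w})"
    by (intro Gcd_greatest) auto
  then have "g dvd 1"
    using irr by (simp only: irreducible_presentation_def)
  then show ?thesis
    by (simp add: g_def coprime_iff_gcd_eq_1)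
qed

definition special_conditions :: "nat \<Rightarrow> bool" where
  "special_conditions \<nu> \<longleftrightarrow>
    (n = \<nu> * length u \<and> length u mod 4 = 2 \<and> length u \<ge> 6) \<and>
    (let C = {i * int \<nu> | i. 0 < i \<and> odd i \<and> i \<le> int n div (2 * int \<nu>) - 2}
     in signed_set_form n C (A_mset n u) \<and> signed_set_form n C (B_mset n u)) \<and>
    (\<exists>q\<^sub>0 :: int. 0 < q\<^sub>0 \<and> q\<^sub>0 < int n \<and> coprime q\<^sub>0 (int \<nu>) \<and>
       Q_mset n u =
         image_mset (\<lambda>j. (q\<^sub>0 + 2 * j * int \<nu>) mod int n)
           (mset_set {j. 0 \<le> j \<and> 2 * j \<le> int n div int \<nu> - 2}))"

lemma special_imp_conditions:
  assumes sp: "special 2 k \<nu> (cyclic_presentation n w)"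
    and "\<not> alternating u" "length u \<ge> 3" "irreducible_presentation n w"
  shows "special_conditions \<nu>"
proof -
  have comp: "bipartite C \<and> diameter C = enat 2" and girth: "girth C > enat 2"
    if "C \<in> components G" for C
    using sp that unfolding special_def by auto
  have inj: "inj_on (ends G) (edges G)"
    using girth by (rule inj_on_ends_of_components)
  \<comment> \<open>Differences are realised by a path starting at subscript 0.\<close>
  have no_tri: "\<not> R s r (a + b)" if "R s t a" "R t r b" for s t r a b
    using no_triangle[OF comp, of "(nat (0 mod int n), s)" "(nat (a mod int n), t)"
        "(nat ((a + b) mod int n), r)"] that adjacent_residue[of 0 s a t]
      adjacent_residue[of a t "a + b" r] adjacent_residue[of 0 s "a + b" r] by simp
  have path: "R s v (a + b + c)" if "R s t a" "R t r b" "R r v c" for s t r v a b c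
    using path_closed[OF comp, of "(nat (0 mod int n), s)" "(nat (a mod int n), t)"
        "(nat ((a + b) mod int n), r)" "(nat ((a + b + c) mod int n), v)"] that
      adjacent_residue[of 0 s a t] adjacent_residue[of a t "a + b" r]
      adjacent_residue[of "a + b" r "a + b + c" v] adjacent_residue[of 0 s "a + b + c" v] by simp
  obtain s0 where s0: "R s0 s0 (int half)" using R_half by blast
  obtain q where q: "R True False q" using R_cross assms(2,3) by fastforce
  obtain m where m: "m > 0" "2 * m dvd int n" and level: "\<And>s a. R s s a \<longleftrightarrow> 2 * m dvd a - m"
    and cross: "\<And>a. R True False a \<longleftrightarrow> 2 * m dvd a - q"
  proof (rule residue_structure[of "int n" R s0 "int half" q])
    show "int n > 0" using n_pos by simp
    show "R s t (a + int n) \<longleftrightarrow> R s t a" for s t a by simp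
    show "R t s (- a)" if "R s t a" for s t a using that by (rule R_sym)
    show "\<not> R s r (a + b)" if "R s t a" "R t r b" for s t r a b using that by (rule no_tri)
    show "R s v (a + b + c)" if "R s t a" "R t r b" "R r v c" for s t r v a b c
      using that by (rule path)
    show "R s0 s0 (int half)" "R True False q" by fact+
  next
    fix m
    assume "m > 0" "2 * m dvd int n" "\<And>s a. R s s a \<longleftrightarrow> 2 * m dvd a - m"
      "\<And>a. R True False a \<longleftrightarrow> 2 * m dvd a - q"
    then show thesis by (rule that)
  qed
  \<comment> \<open>The number of components identifies the structural constant m with
    \<nu>.\<close>
  have "residue_bipartite G (vertex_residue (int (nat m)) q) (nat m)"
    by (rule residue_bipartite_star_graph) (use m level cross in simp_all)
  then have "card (components G) = nat m"
    by (rule residue_bipartite.card_components)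
  then have "nat m = \<nu>"
    using sp by (simp add: special_def)
  then have m_eq: "m = int \<nu>"
    using m(1) by linarith
  obtain l where l: "int n = 2 * m * l" using m(2) by blast
  have "l > 0" using l m(1) n_pos by (metis mult_pos_pos of_nat_0_less_iff zero_less_mult_pos zero_less_numeral)
  have A: "count (differences n True False cyclic_pairs) d = (if 2 * m dvd d - m then 1 else 0)"
    and B: "count (differences n False True cyclic_pairs) d = (if 2 * m dvd d - m then 1 else 0)"
    and Q: "count (differences n True True cyclic_pairs) d = (if 2 * m dvd d - q then 1 else 0)"
    if "d \<in> {0..<int n}" for d
    using count_eq_of_R[OF inj that, of True True] count_eq_of_R[OF inj that, of False False]
      count_eq_of_R[OF inj that, of True False] level[where s = True and a = d]
      level[where s = False and a = d] cross[where a = d]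
    by simp_all
  \<comment> \<open>Level and cross classes both have l = n/(2m) elements, so
    \<open>size_cyclic\<close> gives l(u) = 2l.\<close>
  have card: "card {d \<in> {0..<int n}. 2 * m dvd d - r} = nat l" for r
    using bij_betw_same_card[OF residue_class_bij[OF m(1) l \<open>l > 0\<close>, of r]] by simp
  have "size (differences n True False cyclic_pairs) = nat l"
    using mset_eq_residue_class[OF set_differences[OF n_pos] A] card by (metis size_mset_set)
  moreover have Q_eq: "Q_mset n u = mset_set {d \<in> {0..<int n}. 2 * m dvd d - q}"
    using mset_eq_residue_class[OF set_differences[OF n_pos] Q] by (simp only: Q_mset_cyclic)
  then have "size (Q_mset n u) = nat l" using card by (metis size_mset_set)
  ultimately have len: "length u = 2 * nat l"
    using size_cyclic by (simp add: Q_mset_cyclic)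
  have half: "int half = m * l"
    using half_half l by linarith
  \<comment> \<open>The difference n/2 = ml occurs on some level, so it is m modulo 2m, which makes
    l - 1 even.\<close>
  have "2 * m dvd int half - m" using level s0 by blast
  then have "2 * m dvd m * (l - 1)" by (simp add: half algebra_simps)
  then have "odd l" using m(1) by (simp add: mult.commute[of 2])
  interpret H: half_class n m l "int half"
    by unfold_locales (use m(1) \<open>l > 0\<close> \<open>odd l\<close> l half in auto)
  have "nat l \<ge> 2" using assms(3) len by linarith
  then have "l \<ge> 3"
    using \<open>odd l\<close> by (cases "l = 2") auto
  have "signed_set_form n H.lower (A_mset n u) \<and> junctions_A = 1"
    unfolding H.signed_set_form_iff_doubled[OF set_A'_mset A_mset_eq]
    using A count_cyclic_A by (simp add: H.odd_multiples_def)
  moreover have "signed_set_form n H.lower (B_mset n u) \<and> junctions_B = 1"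
    unfolding H.signed_set_form_iff_doubled[OF set_B'_mset B_mset_eq]
    using B count_cyclic_B by (simp add: H.odd_multiples_def)
  moreover have "n = \<nu> * length u"
  proof -
    have "int n = int (\<nu> * length u)"
      using l len \<open>l > 0\<close> m_eq by simp
    then show ?thesis by (simp only: of_nat_eq_iff)
  qed
  moreover have "length u mod 4 = 2"
  proof -
    have "int (length u) = 2 * l" using len \<open>l > 0\<close> by simp
    moreover obtain j where "l = 2 * j + 1" using \<open>odd l\<close> by (rule oddE)
    ultimately have "int (length u) = 4 * j + 2" by simp
    then show ?thesis by presburger
  qed
  moreover have "length u \<ge> 6"
    using len \<open>l \<ge> 3\<close> by linarith
  moreover have "\<exists>q\<^sub>0. 0 < q\<^sub>0 \<and> q\<^sub>0 < int n \<and> coprime q\<^sub>0 m \<and>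
      Q_mset n u = image_mset (\<lambda>j. (q\<^sub>0 + 2 * j * m) mod int n)
        (mset_set {j. 0 \<le> j \<and> 2 * j \<le> int n div m - 2})"
  proof -
    \<comment> \<open>The representative in {1..2m} rather than {0..<2m}, because q_0 must be
      positive; for m = 1 the class may be that of 0. It lies below n because l \<ge> 3.\<close>
    define q' where "q' = (q - 1) mod (2 * m) + 1"
    have q': "0 < q'" "q' \<le> 2 * m"
    proof -
      have "0 \<le> (q - 1) mod (2 * m)" "(q - 1) mod (2 * m) < 2 * m" using m(1) by simp_all
      then show "0 < q'" "q' \<le> 2 * m" unfolding q'_def by linarith+
    qed
    have "2 * m dvd q' - q"
      using dvd_mod_diff[of "2 * m" "2 * m" "q - 1"] by (simp add: q'_def algebra_simps)
    then have eq: "2 * m dvd a - q \<longleftrightarrow> 2 * m dvd a - q'" for a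
      using dvd_diff_left_iff[of "2 * m" "q' - q" "a - q"] by simp
    have "coprime q' (int \<nu>)"
      by (rule coprime_of_irreducible[OF assms(4)]) (use level cross eq m(2) m_eq in \<open>auto dest: dvd_mult_right\<close>)
    moreover have "2 * m < int n"
      using \<open>l \<ge> 3\<close> m(1) unfolding l by simp
    moreover have "Q_mset n u = mset_set {d \<in> {0..<int n}. 2 * m dvd d - q'}"
      using Q_eq eq by simp
    ultimately show ?thesis
      using q' image_mset_residue_class[OF m(1) l \<open>l > 0\<close>, of q'] m_eq
      by (intro exI[of _ q']) simp
  qed
  ultimately show ?thesis
    unfolding special_conditions_def Let_def H.lower_def unfolding m_eq by blast
qed

lemma conditions_imp_special:
  assumes "special_conditions \<nu>"
  shows "special 2 (length w) \<nu> (cyclic_presentation n w)"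
proof -
  obtain q where n: "n = \<nu> * length u" "length u mod 4 = 2" "length u \<ge> 6"
    and A: "signed_set_form n {i * int \<nu> | i. 0 < i \<and> odd i \<and> i \<le> int n div (2 * int \<nu>) - 2} (A_mset n u)"
    and B: "signed_set_form n {i * int \<nu> | i. 0 < i \<and> odd i \<and> i \<le> int n div (2 * int \<nu>) - 2} (B_mset n u)"
    and Q: "Q_mset n u = image_mset (\<lambda>j. (q + 2 * j * int \<nu>) mod int n)
           (mset_set {j. 0 \<le> j \<and> 2 * j \<le> int n div int \<nu> - 2})"
    using assms unfolding special_conditions_def Let_def by blast
  define l where "l = int (length u div 2)"
  have len: "int (length u) = 2 * l" "odd l" "l \<ge> 3"
    using n(2,3) unfolding l_def by presburger+
  have "\<nu> > 0" using n n_pos by (cases \<nu>) auto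
  have l: "int n = 2 * int \<nu> * l" using n(1) len(1) by simp
  interpret H: half_class n "int \<nu>" l "int half"
    by unfold_locales (use \<open>\<nu> > 0\<close> len l half_half in auto)
  have A': "signed_set_form n H.lower (A_mset n u)" and B': "signed_set_form n H.lower (B_mset n u)"
    using A B by (simp_all only: H.lower_def)
  then have "count (A_mset n u) (int half) = 1" "count (B_mset n u) (int half) = 1"
    by (simp_all only: H.signed_set_form_iff)
  \<comment> \<open>Since n/2 occurs only once in each multiset and there are two junctions in all,
    each level receives exactly one.\<close>
  then have "junctions_A \<le> 1" "junctions_B \<le> 1"
    by (simp_all add: A_mset_eq B_mset_eq)
  moreover have "junctions_A + junctions_B = 2"
    by (simp add: junctions_A_def junctions_B_def)
  ultimately have j: "junctions_A = 1" "junctions_B = 1" by linarith+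
  have cA: "count (differences n True False cyclic_pairs) d = (if d \<in> H.odd_multiples then 1 else 0)"
    if d: "d \<in> {0..<int n}" for d
    using iffD1[OF H.signed_set_form_iff_doubled[OF set_A'_mset A_mset_eq] conjI[OF A' j(1)]] d
      count_cyclic_A[OF d] by simp
  have cB: "count (differences n False True cyclic_pairs) d = (if d \<in> H.odd_multiples then 1 else 0)"
    if d: "d \<in> {0..<int n}" for d
    using iffD1[OF H.signed_set_form_iff_doubled[OF set_B'_mset B_mset_eq] conjI[OF B' j(2)]] d
      count_cyclic_B[OF d] by simp
  have "Q_mset n u = mset_set {d \<in> {0..<int n}. 2 * int \<nu> dvd d - q}"
    unfolding Q using \<open>\<nu> > 0\<close> len(3) by (intro image_mset_residue_class[OF _ l]) auto
  moreover have "finite {d \<in> {0..<int n}. 2 * int \<nu> dvd d - q}"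
    by (rule finite_subset[of _ "{0..<int n}"]) auto
  ultimately have cQ: "count (differences n True True cyclic_pairs) d = (if 2 * int \<nu> dvd d - q then 1 else 0)"
    if d: "d \<in> {0..<int n}" for d
    using d by (simp add: Q_mset_cyclic count_mset_set')
  have dvd_mod: "2 * int \<nu> dvd a mod int n - r \<longleftrightarrow> 2 * int \<nu> dvd a - r" for a r
  proof -
    have "2 * int \<nu> dvd a mod int n - a" using dvd_mod_diff l by simp
    then show ?thesis
      using dvd_add_right_iff[of "2 * int \<nu>" "a mod int n - a" "a - r"] by simp
  qed
  have bounds: "a mod int n \<in> {0..<int n}" for a using n_pos by simp
  have level: "R s s a \<longleftrightarrow> 2 * int \<nu> dvd a - int \<nu>" for s a
  proof -
    have "R s s a \<longleftrightarrow> a mod int n \<in> H.odd_multiples"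
      using cA[OF bounds] cB[OF bounds] by (cases s) (simp_all flip: count_greater_zero_iff)
    then show ?thesis
      using bounds dvd_mod by (simp add: H.odd_multiples_def)
  qed
  have cross: "R True False a \<longleftrightarrow> 2 * int \<nu> dvd a - q" for a
    using cQ[OF bounds] dvd_mod by (simp flip: count_greater_zero_iff)
  have le: "count (differences n s (\<not> t) cyclic_pairs) d \<le> 1" if d: "d \<in> {0..<int n}" for s t d
  proof -
    consider "s" "t" | "\<not> s" "\<not> t" | "s" "\<not> t" | "\<not> s" "t" by blast
    then show ?thesis
    proof cases
      case 4
      \<comment> \<open>Subwords of two negative letters are the inverses of those of two positive
        letters. Reduction modulo n appears because negating d twice leaves d mod n.\<close>
      have "image_mset (\<lambda>x. x mod int n) (differences n False False ps) = differences n False False ps"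
        for ps
        using set_differences[OF n_pos] by (intro multiset.map_ident_strong) fastforce
      then have "differences n False False cyclic_pairs =
          image_mset (\<lambda>d. - d mod int n) (differences n True True cyclic_pairs)"
        unfolding differences_cyclic
        by (simp add: image_mset_union multiset.map_comp comp_def mod_minus_eq)
      then have "count (differences n False False cyclic_pairs) d =
          count (differences n True True cyclic_pairs) (- d mod int n)"
        using count_image_uminus_mod[OF set_differences[OF n_pos] d] by simp
      with 4 cQ[OF bounds] show ?thesis by simp
    qed (use d cA cB cQ in simp_all)
  qed
  have inj: "inj_on (ends G) (edges G)"
    unfolding inj_on_ends_iff
  proof (intro allI ballI)
    fix s t d assume "d \<in> {0..<int n}"
    with le[where d = d and s = s and t = "\<not> t"] show "count (differences n s t cyclic_pairs) d \<le> 1"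
      by simp
  qed
  have "residue_bipartite G (vertex_residue (int \<nu>) q) \<nu>"
    using \<open>\<nu> > 0\<close> l level cross by (intro residue_bipartite_star_graph) auto
  then have "simple_residue_bipartite G (vertex_residue (int \<nu>) q) \<nu>"
    using inj l len(3) by (rule simple_residue_bipartite_star_graph)
  then show ?thesis
    using n(3) by (intro special_of_simple_residue_bipartite) simp_all
qed

end

theorem theorem6p7:
  fixes n k \<nu> :: nat and u w :: "nat word"
  assumes "n \<ge> 2" and "even n"
    and "u \<in> free_group {..<n}" and "\<not> alternating u" and "length u \<ge> 3"
    and "w = free_mult u (word_inv ((shift n ^^ (n div 2)) u))"
    and "length w = k" and "\<not> proper_power {..<n} w"
    and "irreducible_presentation n w"
  shows "special 2 k \<nu> (cyclic_presentation n w) \<longleftrightarrow>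
    (n = \<nu> * length u \<and> length u mod 4 = 2 \<and> length u \<ge> 6) \<and>
    (let C = {i * int \<nu> | i. 0 < i \<and> odd i \<and> i \<le> int n div (2 * int \<nu>) - 2}
     in signed_set_form n C (A_mset n u) \<and> signed_set_form n C (B_mset n u)) \<and>
    (\<exists>q\<^sub>0 :: int. 0 < q\<^sub>0 \<and> q\<^sub>0 < int n \<and> coprime q\<^sub>0 (int \<nu>) \<and>
       Q_mset n u =
         image_mset (\<lambda>j. (q\<^sub>0 + 2 * j * int \<nu>) mod int n)
           (mset_set {j. 0 \<le> j \<and> 2 * j \<le> int n div int \<nu> - 2}))"
proof -
  have "u \<noteq> []" using assms(5) by auto
  then interpret half_shift_word n u w
    using assms by unfold_locales
  show ?thesis
    unfolding special_conditions_def[symmetric]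
    using special_imp_conditions conditions_imp_special assms by blast
qed

end
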